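(* If the stoquastic uniform $k$-local Hamiltonian $H$ is $\varepsilon$-frustrated, then for every string $x\in\Sigma^n$ there is a bad string $y$ for $H$ such that the distance between $x$ and $y$ in $G(H)$ is at most $$k^{\frac{2kd}{\varepsilon}\log_{\left(1+\frac{\varepsilon}{4}\right)}|\Sigma|}.$$
   Context: Let $\Sigma$ be a finite alphabet; $n$-qudit states are unit vectors in $(\mathbb C^\Sigma)^{\otimes n}$. For a nonempty set $T$ of strings, $|T\rangle=|T|^{-1/2}\sum_{x\in T}|x\rangle$. A uniform stoquastic $k$-local Hamiltonian here is $H=\frac1m\sum_{i=1}^m\tilde H_i$ with $\tilde H_i=H_i\otimes I$, each $H_i$ acting on $k$ of the $n$ qudits. Moreover $0\le H_i\le I$ with smallest eigenvalue $0$, all off-diagonal entries of $H_i$ are non-positive, at most $d$ terms act non-trivially on each qudit, and $m\ge n$. The projector $P_i$ onto the groundspace of $H_i$ has the form $P_i=\sum_j|T_{i,j}\rangle\langle T_{i,j}|$ with pairwise disjoint nonempty $T_{i,j}\subseteq\Sigma^k$. Put $\tilde P_i=P_i\otimes I$. $H$ is $\varepsilon$-frustrated ($\varepsilon>0$) if $\langle\psi|H|\psi\rangle\ge\varepsilon$ for every state $|\psi\rangle$. A string $x\in\Sigma^n$ is bad for $H$ if $\langle x|\tilde P_i|x\rangle=0$ for some $i$. $G(H)$ is the undirected graph on vertex set $\Sigma^n$ in which $x,y$ are adjacent iff $\langle x|\tilde P_i|y\rangle>0$ for some $i\in[m]$.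
   Formalization: The formal statement assumes k ≥ 2; for k = 1 the bound equals 1 and the claim fails, e.g. n = 1, |Σ| = 4, with terms linking 1–2, 2–3, 3–4 and one term making only 4 bad, where string 1 is at distance 3 from it. *)

theory Defs
  imports "HOL-Analysis.Analysis"
begin

text \<open>
  The alphabet is a finite type \<open>'a\<close>; strings of length \<open>n = CARD('n)\<close> are functions \<open>'n \<Rightarrow> 'a\<close>,
  and the space of \<open>n\<close>-qudit vectors is \<open>complex ^ ('n \<Rightarrow> 'a)\<close>, with the strings as
  computational basis. Thus the entry \<open>A $ x $ y\<close> is the matrix element \<open>\<langle>x|A|y\<rangle>\<close>.
  Inequalities between complex numbers are those of \<open>HOL-Library.Complex_Order\<close>:
  \<open>a \<le> b\<close> includes \<open>Im a = Im b\<close>.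
\<close>

definition inner_prod :: "complex ^ 'i::finite \<Rightarrow> complex ^ 'i \<Rightarrow> complex" where
  "inner_prod u v = (\<Sum>x\<in>UNIV. cnj (u $ x) * v $ x)"

definition outer_prod :: "complex ^ 'i::finite \<Rightarrow> complex ^ 'i \<Rightarrow> complex ^ 'i ^ 'i" where
  "outer_prod u v = (\<chi> x y. u $ x * cnj (v $ y))"

definition hermitian :: "complex ^ 'i::finite ^ 'i \<Rightarrow> bool" where
  "hermitian A \<longleftrightarrow> (\<forall>x y. A $ x $ y = cnj (A $ y $ x))"

definition psd :: "complex ^ 'i::finite ^ 'i \<Rightarrow> bool" where
  "psd A \<longleftrightarrow> hermitian A \<and> (\<forall>v. 0 \<le> inner_prod v (A *v v))"

definition loewner_le :: "complex ^ 'i::finite ^ 'i \<Rightarrow> complex ^ 'i ^ 'i \<Rightarrow> bool" where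
  "loewner_le A B \<longleftrightarrow> psd (B - A)"

definition eigenvalue :: "complex ^ 'i::finite ^ 'i \<Rightarrow> complex \<Rightarrow> bool" where
  "eigenvalue A c \<longleftrightarrow> (\<exists>v. v \<noteq> 0 \<and> A *v v = c *s v)"

definition smallest_eigenvalue :: "complex ^ 'i::finite ^ 'i \<Rightarrow> complex \<Rightarrow> bool" where
  "smallest_eigenvalue A c \<longleftrightarrow> eigenvalue A c \<and> (\<forall>c'. eigenvalue A c' \<longrightarrow> c \<le> c')"

text \<open>The space spanned by the eigenvectors of the smallest eigenvalue.\<close>

definition groundspace :: "complex ^ 'i::finite ^ 'i \<Rightarrow> (complex ^ 'i) set" where
  "groundspace A = {v. \<exists>c. smallest_eigenvalue A c \<and> A *v v = c *s v}"

definition orthogonal_projector_onto ::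
    "complex ^ 'i::finite ^ 'i \<Rightarrow> (complex ^ 'i) set \<Rightarrow> bool" where
  "orthogonal_projector_onto P S \<longleftrightarrow>
     hermitian P \<and> P ** P = P \<and> range (\<lambda>v. P *v v) = S"

definition ground_projector :: "complex ^ 'i::finite ^ 'i \<Rightarrow> complex ^ 'i ^ 'i" where
  "ground_projector A = (THE P. orthogonal_projector_onto P (groundspace A))"

lemma orthogonal_projector_onto_unique:
  assumes P: "orthogonal_projector_onto P S" and Q: "orthogonal_projector_onto Q S"
  shows "P = Q"
proof -
  have fixes_range: "A ** B = B"
    if A: "orthogonal_projector_onto A S" and B: "orthogonal_projector_onto B S" for A B
  proof -
    have "(A ** B) *v v = B *v v" for v
    proof -
      have "B *v v \<in> range (\<lambda>v. A *v v)"
        using A B by (auto simp: orthogonal_projector_onto_def)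
      then obtain w where w: "B *v v = A *v w" by auto
      have "(A ** B) *v v = A *v (A *v w)"
        by (simp add: w flip: matrix_vector_mul_assoc)
      also have "\<dots> = A *v w"
        using A by (simp add: matrix_vector_mul_assoc orthogonal_projector_onto_def)
      finally show ?thesis by (simp add: w)
    qed
    then show ?thesis by (simp add: matrix_eq)
  qed
  have herm: "hermitian P" "hermitian Q"
    using P Q by (auto simp: orthogonal_projector_onto_def)
  have "P $ x $ y = Q $ x $ y" for x y
  proof -
    have "P $ x $ y = (Q ** P) $ x $ y" by (simp add: fixes_range[OF Q P])
    also have "\<dots> = (\<Sum>z\<in>UNIV. Q $ x $ z * P $ z $ y)"
      by (simp add: matrix_matrix_mult_def)
    also have "\<dots> = (\<Sum>z\<in>UNIV. cnj (P $ y $ z * Q $ z $ x))"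
    proof (rule sum.cong)
      fix z
      have "Q $ x $ z = cnj (Q $ z $ x)" "P $ z $ y = cnj (P $ y $ z)"
        using herm unfolding hermitian_def by blast+
      then show "Q $ x $ z * P $ z $ y = cnj (P $ y $ z * Q $ z $ x)" by simp
    qed simp
    also have "\<dots> = cnj ((P ** Q) $ y $ x)" by (simp add: matrix_matrix_mult_def)
    also have "\<dots> = cnj (Q $ y $ x)" by (simp add: fixes_range[OF P Q])
    also have "\<dots> = Q $ x $ y" using herm(2) unfolding hermitian_def by metis
    finally show ?thesis .
  qed
  then show ?thesis by (simp add: vec_eq_iff)
qed

lemma ground_projector_eqI:
  "orthogonal_projector_onto P (groundspace A) \<Longrightarrow> ground_projector A = P"
  unfolding ground_projector_def by (blast intro: orthogonal_projector_onto_unique)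

definition subset_state :: "'i set \<Rightarrow> complex ^ 'i::finite" where
  "subset_state T = (\<chi> x. if x \<in> T then 1 / complex_of_real (sqrt (real (card T))) else 0)"

text \<open>
  The family \<open>\<T>\<close> is the set of all \<open>T\<^bsub>i,j\<^esub>\<close> for one fixed \<open>i\<close>. Through \<open>ground_projector_eqI\<close>,
  the last conjunct says that the sum is \<open>ground_projector A\<close>.
\<close>

definition uniform_groundspace :: "complex ^ 'i::finite ^ 'i \<Rightarrow> bool" where
  "uniform_groundspace A \<longleftrightarrow>
     (\<exists>\<T>. disjoint \<T> \<and> {} \<notin> \<T> \<and>
       orthogonal_projector_onto
         (\<Sum>T\<in>\<T>. outer_prod (subset_state T) (subset_state T)) (groundspace A))"

text \<open>
  \<open>lift_op l A\<close> is \<open>A \<otimes> I\<close>, where the \<open>j\<close>-th tensor factor of \<open>A\<close> is qudit \<open>l j\<close>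
  (\<open>l\<close> is injective) and \<open>I\<close> acts on the qudits outside \<open>range l\<close>.
\<close>

definition lift_op ::
    "('k \<Rightarrow> 'n) \<Rightarrow> complex ^ ('k::finite \<Rightarrow> 'a::finite) ^ ('k \<Rightarrow> 'a)
      \<Rightarrow> complex ^ ('n::finite \<Rightarrow> 'a) ^ ('n \<Rightarrow> 'a)" where
  "lift_op l A = (\<chi> x y. if \<forall>q. q \<notin> range l \<longrightarrow> x q = y q then A $ (x \<circ> l) $ (y \<circ> l) else 0)"

text \<open>
  \<open>A\<close> acts trivially on qudit \<open>q\<close> if \<open>A = I \<otimes> B\<close> with \<open>I\<close> acting on \<open>q\<close>; overwriting position \<open>q\<close>
  by \<open>undefined\<close> makes the entries of \<open>B\<close> depend on the other positions only.
\<close>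

definition acts_trivially_on ::
    "'n \<Rightarrow> complex ^ ('n::finite \<Rightarrow> 'a::finite) ^ ('n \<Rightarrow> 'a) \<Rightarrow> bool" where
  "acts_trivially_on q A \<longleftrightarrow>
     (\<exists>B :: ('n \<Rightarrow> 'a) \<Rightarrow> ('n \<Rightarrow> 'a) \<Rightarrow> complex.
       \<forall>x y. A $ x $ y = (if x q = y q then B (x(q := undefined)) (y(q := undefined)) else 0))"

text \<open>
  The terms are \<open>h i\<close> for \<open>i < m\<close>, and \<open>h i\<close> acts on the qudits \<open>loc i j\<close>.
\<close>

definition uniform_stoquastic_terms ::
    "nat \<Rightarrow> nat \<Rightarrow> (nat \<Rightarrow> 'k \<Rightarrow> 'n::finite)
      \<Rightarrow> (nat \<Rightarrow> complex ^ ('k::finite \<Rightarrow> 'a::finite) ^ ('k \<Rightarrow> 'a)) \<Rightarrow> bool" where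
  "uniform_stoquastic_terms m d loc h \<longleftrightarrow>
     CARD('n) \<le> m \<and>
     (\<forall>i<m. inj (loc i) \<and>
        loewner_le 0 (h i) \<and> loewner_le (h i) (mat 1) \<and>
        smallest_eigenvalue (h i) 0 \<and>
        (\<forall>x y. x \<noteq> y \<longrightarrow> h i $ x $ y \<le> 0) \<and>
        uniform_groundspace (h i)) \<and>
     (\<forall>q. card {i. i < m \<and> \<not> acts_trivially_on q (lift_op (loc i) (h i))} \<le> d)"

definition hamiltonian ::
    "nat \<Rightarrow> (nat \<Rightarrow> 'k \<Rightarrow> 'n)
      \<Rightarrow> (nat \<Rightarrow> complex ^ ('k::finite \<Rightarrow> 'a::finite) ^ ('k \<Rightarrow> 'a))
      \<Rightarrow> complex ^ ('n::finite \<Rightarrow> 'a) ^ ('n \<Rightarrow> 'a)" where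
  "hamiltonian m loc h = (1 / real m) *\<^sub>R (\<Sum>i<m. lift_op (loc i) (h i))"

definition frustrated :: "real \<Rightarrow> complex ^ 'i::finite ^ 'i \<Rightarrow> bool" where
  "frustrated \<epsilon> A \<longleftrightarrow> (\<forall>\<psi>. norm \<psi> = 1 \<longrightarrow> complex_of_real \<epsilon> \<le> inner_prod \<psi> (A *v \<psi>))"

definition lifted_projector ::
    "(nat \<Rightarrow> 'k \<Rightarrow> 'n) \<Rightarrow> (nat \<Rightarrow> complex ^ ('k::finite \<Rightarrow> 'a::finite) ^ ('k \<Rightarrow> 'a))
      \<Rightarrow> nat \<Rightarrow> complex ^ ('n::finite \<Rightarrow> 'a) ^ ('n \<Rightarrow> 'a)" where
  "lifted_projector loc h i = lift_op (loc i) (ground_projector (h i))"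

definition bad_string ::
    "nat \<Rightarrow> (nat \<Rightarrow> 'k \<Rightarrow> 'n::finite)
      \<Rightarrow> (nat \<Rightarrow> complex ^ ('k::finite \<Rightarrow> 'a::finite) ^ ('k \<Rightarrow> 'a)) \<Rightarrow> ('n \<Rightarrow> 'a) \<Rightarrow> bool" where
  "bad_string m loc h x \<longleftrightarrow> (\<exists>i<m. lifted_projector loc h i $ x $ x = 0)"

text \<open>The graph \<open>G(H)\<close>, given by its adjacency relation.\<close>

definition config_graph ::
    "nat \<Rightarrow> (nat \<Rightarrow> 'k \<Rightarrow> 'n::finite)
      \<Rightarrow> (nat \<Rightarrow> complex ^ ('k::finite \<Rightarrow> 'a::finite) ^ ('k \<Rightarrow> 'a)) \<Rightarrow> ('n \<Rightarrow> 'a) rel" where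
  "config_graph m loc h = {(x, y). \<exists>i<m. 0 < lifted_projector loc h i $ x $ y}"

text \<open>Infinite if there is no walk from \<open>x\<close> to \<open>y\<close>.\<close>

definition graph_dist :: "'v rel \<Rightarrow> 'v \<Rightarrow> 'v \<Rightarrow> enat" where
  "graph_dist E x y = (INF l\<in>{l. (x, y) \<in> E ^^ l}. enat l)"

end

theory Submission
  imports Defs
begin

text \<open>
  Let \<open>S\<close> be a set of strings without bad strings. Since \<open>H\<^sub>i \<le> I - P\<^sub>i\<close>, frustration
  of the state \<open>|S\<rangle>\<close> says that \<open>1 - \<langle>S|P\<^sub>i|S\<rangle>\<close> is at least \<open>\<epsilon>\<close> on average, so that it is at
  least \<open>\<epsilon>/2\<close> for at least \<open>\<epsilon>m/2\<close> terms; by Cauchy--Schwarz, closing \<open>S\<close> under such a term multiplies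
  its size by \<open>1 + \<epsilon>/2\<close>. As a term meets at most \<open>kd\<close> others, one can apply a layer of \<open>\<epsilon>m/(2kd)\<close>
  pairwise disjoint terms in turn. After more than \<open>(2kd/\<epsilon>) log\<^bsub>1+\<epsilon>/2\<^esub> |\<Sigma>|\<close> layers, \<open>S\<close> would exceed
  \<open>|\<Sigma>|\<^sup>n\<close> strings, so a bad string is met before. Being bad for a term only depends on its at most
  \<open>k\<close> qudits, so it suffices to perform the steps in the backward light cone of these qudits, which
  grows by the factor \<open>k\<close> per layer.
\<close>

subsection \<open>Expansion and light cones\<close>

text \<open>\<open>p i\<close> abstracts the matrix of the \<open>i\<close>-th lifted ground projector, and \<open>supp i\<close> the set of qudits
  on which the \<open>i\<close>-th term acts non-trivially. This may be smaller than the set of its \<open>k\<close> qudits,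
  but only non-trivial actions are counted by \<open>d\<close>.\<close>

locale local_relations =
  fixes m k d :: nat and \<epsilon> :: real
    and supp :: "nat \<Rightarrow> 'n::finite set"
    and p :: "nat \<Rightarrow> ('n \<Rightarrow> 'a::finite) \<Rightarrow> ('n \<Rightarrow> 'a) \<Rightarrow> real"
  assumes k_ge_2: "2 \<le> k"
    and card_le_m: "CARD('n) \<le> m"
    and \<epsilon>_pos: "0 < \<epsilon>"
    and card_supp: "i < m \<Longrightarrow> card (supp i) \<le> k"
    and degree: "card {i. i < m \<and> q \<in> supp i} \<le> d"
    and p_nonneg: "i < m \<Longrightarrow> 0 \<le> p i x y"
    and p_sym: "i < m \<Longrightarrow> p i x y = p i y x"
    and p_idem: "i < m \<Longrightarrow> (\<Sum>z\<in>UNIV. p i x z * p i z y) = p i x y"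
    and p_row: "i < m \<Longrightarrow> p i x x \<noteq> 0 \<Longrightarrow> (\<Sum>y\<in>UNIV. p i x y) = 1"
    and p_off: "i < m \<Longrightarrow> 0 < p i x y \<Longrightarrow> q \<notin> supp i \<Longrightarrow> x q = y q"
    and p_local: "i < m \<Longrightarrow> (\<And>q. q \<notin> supp i \<Longrightarrow> x q = y q) \<Longrightarrow> (\<And>q. q \<notin> supp i \<Longrightarrow> x' q = y' q) \<Longrightarrow>
      (\<And>q. q \<in> supp i \<Longrightarrow> x' q = x q) \<Longrightarrow> (\<And>q. q \<in> supp i \<Longrightarrow> y' q = y q) \<Longrightarrow> p i x' y' = p i x y"
    and frustration: "\<epsilon> * real m * real (card S) \<le>
      (\<Sum>i<m. real (card S) - (\<Sum>x\<in>S. \<Sum>y\<in>S. p i x y))"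
begin

section \<open>Walks along lists of terms\<close>

definition bad :: "('n \<Rightarrow> 'a) \<Rightarrow> bool" where
  "bad x \<longleftrightarrow> (\<exists>i<m. p i x x = 0)"

definition R :: "nat \<Rightarrow> ('n \<Rightarrow> 'a) rel" where
  "R i = {(x, y). 0 < p i x y}"

definition E :: "('n \<Rightarrow> 'a) rel" where
  "E = (\<Union>i<m. R i)"

definition moves :: "nat list \<Rightarrow> ('n \<Rightarrow> 'a) rel" where
  "moves L = fold (\<lambda>i r. r O R i) L Id"

text \<open>With a symmetric relation, \<open>sorted_wrt\<close> makes the supports pairwise
  disjoint. A list rather than a set, so that inductions can peel off the last step of a
  walk.\<close>

definition layer :: "nat list \<Rightarrow> bool" where
  "layer L \<longleftrightarrow> set L \<subseteq> {..<m} \<and> sorted_wrt (\<lambda>i j. supp i \<inter> supp j = {}) L"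

lemma moves_Nil [simp]: "moves [] = Id"
  by (simp add: moves_def)

lemma moves_snoc [simp]: "moves (L @ [i]) = moves L O R i"
  by (simp add: moves_def)

lemma moves_append: "moves (L @ L') = moves L O moves L'"
proof (induction L' rule: rev_induct)
  case (snoc i L')
  have "moves (L @ L' @ [i]) = moves ((L @ L') @ [i])" by simp
  then show ?case using snoc by (simp only: moves_snoc O_assoc)
qed simp

section \<open>Frustration forces expansion\<close>

lemma m_pos: "0 < m"
  using card_le_m by (metis zero_less_card_finite less_le_trans)

text \<open>A basis state has energy at most 1, because the diagonal entries \<open>p i x x\<close>
  are nonnegative.\<close>

lemma \<epsilon>_le_1: "\<epsilon> \<le> 1"
proof -
  fix x :: "'n \<Rightarrow> 'a"
  have "\<epsilon> * real m \<le> (\<Sum>i<m. 1 - p i x x)"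
    using frustration[of "{x}"] by simp
  also have "\<dots> \<le> (\<Sum>i<m. 1)"
    by (rule sum_mono) (use p_nonneg in auto)
  finally show ?thesis using m_pos by simp
qed

text \<open>Cauchy--Schwarz for \<open>f\<close>, the image under \<open>p i\<close> of the indicator function of \<open>S\<close>: it is
  supported on \<open>R i `` S\<close>, has total mass \<open>card S\<close>, and its square sum is the quadratic form of \<open>p i\<close>
  by idempotence.\<close>

lemma card_image_ge:
  assumes i: "i < m" and good: "\<And>x. x \<in> S \<Longrightarrow> \<not> bad x"
  shows "(real (card S))\<^sup>2 \<le> real (card (R i `` S)) * (\<Sum>x\<in>S. \<Sum>y\<in>S. p i x y)"
proof -
  define f where "f y = (\<Sum>x\<in>S. p i x y)" for y
  define N where "N = R i `` S"
  have f0: "f y = 0" if "y \<notin> N" for y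
  proof -
    have "p i x y = 0" if "x \<in> S" for x
      using that \<open>y \<notin> N\<close> p_nonneg[OF i, of x y] by (force simp: N_def R_def)
    then show ?thesis by (simp add: f_def)
  qed
  have "(\<Sum>y\<in>N. f y) = (\<Sum>y\<in>UNIV. f y)"
    by (rule sum.mono_neutral_left) (use f0 in auto)
  also have "\<dots> = (\<Sum>x\<in>S. \<Sum>y\<in>UNIV. p i x y)"
    unfolding f_def by (rule sum.swap)
  also have "\<dots> = real (card S)"
    using good p_row[OF i] i by (simp add: bad_def)
  finally have mass: "(\<Sum>y\<in>N. f y) = real (card S)" .
  have "(\<Sum>y\<in>N. (f y)\<^sup>2) = (\<Sum>y\<in>UNIV. (f y)\<^sup>2)"
    by (rule sum.mono_neutral_left) (use f0 in auto)
  also have "\<dots> = (\<Sum>z\<in>UNIV. \<Sum>x\<in>S. \<Sum>y\<in>S. p i x z * p i z y)"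
    unfolding f_def power2_eq_square sum_product by (simp add: p_sym[OF i])
  also have "\<dots> = (\<Sum>x\<in>S. \<Sum>z\<in>UNIV. \<Sum>y\<in>S. p i x z * p i z y)"
    by (rule sum.swap)
  also have "\<dots> = (\<Sum>x\<in>S. \<Sum>y\<in>S. \<Sum>z\<in>UNIV. p i x z * p i z y)"
    by (intro sum.cong refl sum.swap)
  also have "\<dots> = (\<Sum>x\<in>S. \<Sum>y\<in>S. p i x y)"
    by (simp add: p_idem[OF i])
  finally have "(\<Sum>y\<in>N. (f y)\<^sup>2) = (\<Sum>x\<in>S. \<Sum>y\<in>S. p i x y)" .
  with Cauchy_Schwarz_ineq_sum[of "\<lambda>_. 1" f N] mass show ?thesis
    by (simp add: N_def)
qed

text \<open>Averaging: if every term outside \<open>B\<close> had \<open>1 - <S|P_i|S>\<close> below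
  \<open>\<epsilon> / 2\<close>, the average would stay below \<epsilon>, since the terms of
  \<open>B\<close> add at most \<open>card B\<close> in total. In \<open>layer_growth\<close>,
  \<open>B\<close> holds the terms that meet the layer built so far.\<close>

lemma exists_expanding_term:
  assumes "S \<noteq> {}" and good: "\<And>x. x \<in> S \<Longrightarrow> \<not> bad x"
    and B: "B \<subseteq> {..<m}" "real (card B) < \<epsilon> * real m / 2"
  obtains i where "i < m" "i \<notin> B" "(1 + \<epsilon> / 2) * real (card S) \<le> real (card (R i `` S))"
proof -
  define s where "s = real (card S)"
  define w where "w i = (\<Sum>x\<in>S. \<Sum>y\<in>S. p i x y)" for i
  have s: "0 < s" using assms(1) by (simp add: s_def card_gt_0_iff)
  have "\<exists>i<m. i \<notin> B \<and> w i \<le> (1 - \<epsilon> / 2) * s"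
  proof (rule ccontr)
    assume "\<not> ?thesis"
    then have less: "s - w i \<le> \<epsilon> / 2 * s" if "i < m" "i \<notin> B" for i
      using that by (force simp: algebra_simps)
    have "(\<Sum>i<m. s - w i) = (\<Sum>i\<in>{..<m} - B. s - w i) + (\<Sum>i\<in>B. s - w i)"
      by (rule sum.subset_diff) (use B in auto)
    also have "\<dots> \<le> (\<Sum>i\<in>{..<m} - B. \<epsilon> / 2 * s) + (\<Sum>i\<in>B. s)"
    proof (intro add_mono sum_mono)
      fix i assume "i \<in> B"
      then have "0 \<le> w i"
        unfolding w_def using B p_nonneg by (intro sum_nonneg) auto
      then show "s - w i \<le> s" by simp
    qed (use less in auto)
    also have "\<dots> \<le> real m * (\<epsilon> / 2 * s) + real (card B) * s"
      using s \<epsilon>_pos card_Diff_subset_Int[of "{..<m}" B] by (auto intro!: mult_right_mono)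
    also have "\<dots> < real m * (\<epsilon> / 2 * s) + (\<epsilon> * real m / 2) * s"
      by (intro add_strict_left_mono mult_strict_right_mono B(2) s)
    also have "\<dots> = \<epsilon> * real m * s" by (simp add: algebra_simps)
    finally show False
      using frustration[of S] by (simp add: s_def w_def)
  qed
  then obtain i where i: "i < m" "i \<notin> B" "w i \<le> (1 - \<epsilon> / 2) * s" by auto
  have "s\<^sup>2 \<le> real (card (R i `` S)) * w i"
    using card_image_ge[OF i(1) good] by (simp add: s_def w_def)
  also have "\<dots> \<le> real (card (R i `` S)) * ((1 - \<epsilon> / 2) * s)"
    using i(3) by (intro mult_left_mono) auto
  finally have 1: "s \<le> real (card (R i `` S)) * (1 - \<epsilon> / 2)"
    using s by (simp add: power2_eq_square)
  \<comment> \<open>The growth factor \<open>1 / (1 - \<epsilon> / 2)\<close> is at least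
    \<open>1 + \<epsilon> / 2\<close>, as the product of \<open>1 + \<epsilon> / 2\<close> and
    \<open>1 - \<epsilon> / 2\<close> is at most 1.\<close>
  have "(1 + \<epsilon> / 2) * s \<le> (1 + \<epsilon> / 2) * (real (card (R i `` S)) * (1 - \<epsilon> / 2))"
    using 1 \<epsilon>_pos by (intro mult_left_mono) auto
  also have "\<dots> = real (card (R i `` S)) * (1 - \<epsilon>\<^sup>2 / 4)"
    by (simp add: algebra_simps power2_eq_square)
  also have "\<dots> \<le> real (card (R i `` S))"
    by (intro mult_left_le) auto
  finally show ?thesis using that i by (simp add: s_def)
qed

section \<open>Backward light cones\<close>

text \<open>Given that \<open>y\<close> is reached from \<open>x\<close> through \<open>L\<close>, only the terms of \<open>L\<close> whose support meets \<open>Q\<close>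
  are needed to reproduce \<open>y\<close> on \<open>Q\<close>. By disjointness there are \<open>c \<le> card Q\<close> of them, and each
  enlarges \<open>Q\<close> by at most \<open>k - 1\<close> qudits.\<close>

lemma layer_cone:
  assumes "layer L" "(x, y) \<in> moves L"
  shows "\<exists>Q' c. c \<le> card (Q \<inter> \<Union>(supp ` set L)) \<and> card Q' \<le> card Q + (k - 1) * c \<and>
    (\<forall>x'. (\<forall>q\<in>Q'. x' q = x q) \<longrightarrow> (\<exists>y'. (\<forall>q\<in>Q. y' q = y q) \<and> (x', y') \<in> E ^^ c))"
  using assms
proof (induction L arbitrary: y Q rule: rev_induct)
  case Nil
  then show ?case by (intro exI[of _ Q] exI[of _ 0]) auto
next
  case (snoc i L)
  let ?V = "\<Union>(supp ` set L)"
  from snoc.prems have L: "layer L" "i < m" and disj: "supp i \<inter> ?V = {}"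
    by (auto simp: layer_def sorted_wrt_append)
  from snoc.prems(2) obtain z where z: "(x, z) \<in> moves L" "0 < p i z y"
    by (auto simp: R_def)
  show ?case
  proof (cases "supp i \<inter> Q = {}")
    case True
    \<comment> \<open>The last term leaves \<open>Q\<close> unchanged, so it is skipped.\<close>
    then have zy: "\<forall>q\<in>Q. z q = y q" using p_off[OF L(2) z(2)] by blast
    have "Q \<inter> \<Union>(supp ` set (L @ [i])) = Q \<inter> ?V" using True by auto
    then show ?thesis using snoc.IH[OF L(1) z(1), of Q] zy by simp
  next
    case False
    \<comment> \<open>The last term is replayed, so \<open>z\<close> must also be reproduced on
      \<open>supp i\<close>. By disjointness this adds no qudit of \<open>?V\<close> to the
      count.\<close>
    from snoc.IH[OF L(1) z(1), of "Q \<union> supp i"] obtain Q' c where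
      c: "c \<le> card ((Q \<union> supp i) \<inter> ?V)" "card Q' \<le> card (Q \<union> supp i) + (k - 1) * c"
      and ex: "\<And>x'. (\<forall>q\<in>Q'. x' q = x q) \<Longrightarrow>
        (\<exists>z'. (\<forall>q\<in>Q \<union> supp i. z' q = z q) \<and> (x', z') \<in> E ^^ c)"
      by auto
    have "card ((Q \<union> supp i) \<inter> ?V) = card (Q \<inter> ?V)"
      using disj by (intro arg_cong[where f=card]) auto
    moreover have "card (Q \<inter> \<Union>(supp ` set (L @ [i]))) = card (Q \<inter> ?V) + card (supp i \<inter> Q)"
      by (subst card_Un_disjoint[symmetric]) (use disj in \<open>auto intro!: arg_cong[where f=card]\<close>)
    moreover have pos: "0 < card (supp i \<inter> Q)" using False by (simp add: card_gt_0_iff)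
    ultimately have 1: "Suc c \<le> card (Q \<inter> \<Union>(supp ` set (L @ [i])))"
      using c(1) by linarith
    have "card Q + card (supp i) = card (Q \<union> supp i) + card (supp i \<inter> Q)"
      using card_Un_Int[of Q "supp i"] by (simp add: Int_commute)
    then have "card (Q \<union> supp i) \<le> card Q + (k - 1)"
      using card_supp[OF L(2)] pos by linarith
    then have 2: "card Q' \<le> card Q + (k - 1) * Suc c" using c(2) by simp
    have "\<exists>y'. (\<forall>q\<in>Q. y' q = y q) \<and> (x', y') \<in> E ^^ Suc c" if x': "\<forall>q\<in>Q'. x' q = x q" for x'
    proof -
      from ex[OF x'] obtain z' where z': "\<forall>q\<in>Q \<union> supp i. z' q = z q" "(x', z') \<in> E ^^ c" by auto
      \<comment> \<open>\<open>y'\<close> replays the last step from \<open>z'\<close>: it copies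
        \<open>y\<close> on the support and keeps \<open>z'\<close> elsewhere, so
        \<open>p_local\<close> gives this step the same weight.\<close>
      define y' where "y' q = (if q \<in> supp i then y q else z' q)" for q
      have "p i z' y' = p i z y"
        by (rule p_local[OF L(2)]) (use z' p_off[OF L(2) z(2)] in \<open>auto simp: y'_def\<close>)
      then have "(z', y') \<in> E" using z(2) L(2) unfolding E_def R_def by (auto intro: bexI[of _ i])
      moreover have "\<forall>q\<in>Q. y' q = y q"
        using z'(1) p_off[OF L(2) z(2)] by (auto simp: y'_def)
      ultimately show ?thesis using z'(2) by auto
    qed
    with 1 2 show ?thesis by (intro exI[of _ Q'] exI[of _ "Suc c"]) simp
  qed
qed

text \<open>Going backwards, the last layer costs at most \<open>card Q\<close> steps and enlarges
  \<open>Q\<close> at most \<open>k\<close>-fold. Adding \<open>card Q\<close> on the left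
  strengthens the bound to \<open>c <= card Q * (k ^ T - 1)\<close> for \<open>T\<close> layers,
  which the induction needs.\<close>

lemma light_cone:
  assumes "\<And>L. L \<in> set Ls \<Longrightarrow> layer L" "(x, y) \<in> moves (concat Ls)"
  shows "\<exists>c y'. c + card Q \<le> card Q * k ^ length Ls \<and>
    (\<forall>q\<in>Q. y' q = y q) \<and> (x, y') \<in> E ^^ c"
proof -
  \<comment> \<open>The induction runs over all starts \<open>x'\<close> that agree with
    \<open>x\<close> on the cone \<open>Q'\<close>, since intermediate strings are reproduced only
    partially.\<close>
  have "\<exists>Q' c. c + card Q \<le> card Q * k ^ length Ls \<and>
    (\<forall>x'. (\<forall>q\<in>Q'. x' q = x q) \<longrightarrow> (\<exists>y'. (\<forall>q\<in>Q. y' q = y q) \<and> (x', y') \<in> E ^^ c))"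
    using assms
  proof (induction Ls arbitrary: y Q rule: rev_induct)
    case Nil
    then show ?case by (intro exI[of _ Q] exI[of _ 0]) auto
  next
    case (snoc L Ls)
    from snoc.prems(2) obtain z where z: "(x, z) \<in> moves (concat Ls)" "(z, y) \<in> moves L"
      by (auto simp: moves_append)
    from layer_cone[OF _ z(2), of Q] snoc.prems(1) obtain Q1 c1 where
      c1: "c1 \<le> card (Q \<inter> \<Union>(supp ` set L))" "card Q1 \<le> card Q + (k - 1) * c1"
      and ex1: "\<And>x'. (\<forall>q\<in>Q1. x' q = z q) \<Longrightarrow> (\<exists>y'. (\<forall>q\<in>Q. y' q = y q) \<and> (x', y') \<in> E ^^ c1)"
      by auto
    from snoc.IH[OF _ z(1), of Q1] snoc.prems(1) obtain Q2 c2 where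
      c2: "c2 + card Q1 \<le> card Q1 * k ^ length Ls"
      and ex2: "\<And>x'. (\<forall>q\<in>Q2. x' q = x q) \<Longrightarrow> (\<exists>y'. (\<forall>q\<in>Q1. y' q = z q) \<and> (x', y') \<in> E ^^ c2)"
      by auto
    have c1': "c1 \<le> card Q"
      using c1(1) card_mono[of Q "Q \<inter> \<Union>(supp ` set L)"] by simp
    have le: "card Q1 \<le> card Q + (k - 1) * card Q"
      using c1(2) c1' by (meson add_left_mono mult_le_mono2 order_trans)
    also have "\<dots> = k * card Q" using k_ge_2 by (simp add: algebra_simps)
    finally have q1: "card Q1 \<le> k * card Q" .
    have "c2 + c1 + card Q \<le> card Q * k ^ length (Ls @ [L])"
    proof -
      have "real c2 \<le> real (card Q1) * (real k ^ length Ls - 1)"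
      proof -
        have "real (c2 + card Q1) \<le> real (card Q1 * k ^ length Ls)"
          using c2 by (subst of_nat_le_iff)
        then show ?thesis by (simp add: algebra_simps)
      qed
      also have "\<dots> \<le> real (k * card Q) * (real k ^ length Ls - 1)"
        using q1 k_ge_2 by (intro mult_right_mono, subst of_nat_le_iff) auto
      finally have "real c2 \<le> real (card Q) * real k ^ Suc (length Ls) - real k * real (card Q)"
        by (simp add: algebra_simps)
      \<comment> \<open>The surplus \<open>k * card Q\<close> pays for both \<open>c1\<close> and
        the added \<open>card Q\<close>.\<close>
      moreover have "2 * real (card Q) \<le> real k * real (card Q)"
        using k_ge_2 by (intro mult_right_mono) auto
      ultimately have "real (c2 + c1 + card Q) \<le> real (card Q * k ^ Suc (length Ls))"
        using c1' by simp
      then show ?thesis unfolding of_nat_le_iff by simp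
    qed
    moreover have "\<exists>y'. (\<forall>q\<in>Q. y' q = y q) \<and> (x', y') \<in> E ^^ (c2 + c1)"
      if "\<forall>q\<in>Q2. x' q = x q" for x'
    proof -
      from ex2[OF that] obtain z' where z': "\<forall>q\<in>Q1. z' q = z q" "(x', z') \<in> E ^^ c2" by blast
      from ex1[OF z'(1)] obtain y' where "\<forall>q\<in>Q. y' q = y q" "(z', y') \<in> E ^^ c1" by blast
      with z'(2) show ?thesis by (auto simp: relpow_add)
    qed
    ultimately show ?case by (intro exI[of _ Q2] exI[of _ "c2 + c1"]) simp
  qed
  then obtain Q' c where "c + card Q \<le> card Q * k ^ length Ls"
    "\<And>x'. \<forall>q\<in>Q'. x' q = x q \<Longrightarrow> \<exists>y'. (\<forall>q\<in>Q. y' q = y q) \<and> (x', y') \<in> E ^^ c"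
    by metis
  then show ?thesis by (intro exI[of _ c]) auto
qed

text \<open>Take \<open>Q = supp i\<close> for a term with \<open>p i y y = 0\<close>: by
  \<open>p_local\<close> this entry depends on \<open>y\<close> only through the support, and
  \<open>card Q <= k\<close> gives the extra factor \<open>k\<close>.\<close>

lemma bad_within_light_cone:
  assumes "\<And>L. L \<in> set Ls \<Longrightarrow> layer L" "(x, y) \<in> moves (concat Ls)" "bad y"
  obtains y' c where "bad y'" "(x, y') \<in> E ^^ c" "c \<le> k ^ Suc (length Ls)"
proof -
  from assms(3) obtain i where i: "i < m" "p i y y = 0" by (auto simp: bad_def)
  from light_cone[OF assms(1,2), of "supp i"] obtain c y' where
    c: "c + card (supp i) \<le> card (supp i) * k ^ length Ls"
    and y': "\<forall>q\<in>supp i. y' q = y q" "(x, y') \<in> E ^^ c"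
    by auto
  have "p i y' y' = p i y y"
    by (rule p_local[OF i(1)]) (use y' in auto)
  then have "bad y'" using i by (auto simp: bad_def)
  moreover have "c \<le> k ^ Suc (length Ls)"
  proof -
    have "c \<le> card (supp i) * k ^ length Ls" using c by simp
    also have "\<dots> \<le> k * k ^ length Ls" by (rule mult_le_mono1[OF card_supp[OF i(1)]])
    finally show ?thesis by simp
  qed
  ultimately show ?thesis using that y'(2) by blast
qed

section \<open>Growth over successive layers\<close>

text \<open>A layer of \<open>s\<close> terms meets at most \<open>s k d\<close> terms, while for every set of good strings about
  \<open>\<epsilon> m / 2\<close> terms expand it, so the layer can be extended as long as \<open>s k d < \<epsilon> m / 2\<close>.\<close>

lemma layer_growth:
  assumes Ls: "\<And>L. L \<in> set Ls \<Longrightarrow> layer L"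
    and good: "\<And>y c. (x, y) \<in> E ^^ c \<Longrightarrow> c \<le> k ^ (length Ls + 2) \<Longrightarrow> \<not> bad y"
    and S: "S = moves (concat Ls) `` {x}" "S \<noteq> {}"
    and "0 < s \<Longrightarrow> real (s - 1) * (real k * real d) < \<epsilon> * real m / 2"
  shows "\<exists>L. layer L \<and> length L = s \<and> (1 + \<epsilon> / 2) ^ s * real (card S) \<le> real (card (moves L `` S))"
  using assms(5)
proof (induction s)
  case 0
  then show ?case by (intro exI[of _ "[]"]) (auto simp: layer_def)
next
  case (Suc s)
  have "0 < s \<Longrightarrow> real (s - 1) * (real k * real d) \<le> real s * (real k * real d)"
    by (intro mult_right_mono) auto
  with Suc obtain L where L: "layer L" "length L = s"
    "(1 + \<epsilon> / 2) ^ s * real (card S) \<le> real (card (moves L `` S))"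
    by fastforce
  let ?S = "moves L `` S"
  let ?V = "\<Union>(supp ` set L)"
  \<comment> \<open>The terms that would break the disjointness of the layer.\<close>
  define B where "B = {i. i < m \<and> supp i \<inter> ?V \<noteq> {}}"
  have "0 < (1 + \<epsilon> / 2) ^ s * real (card S)"
    using S(2) \<epsilon>_pos by (intro mult_pos_pos zero_less_power) (auto simp: card_gt_0_iff)
  then have ne: "?S \<noteq> {}" using L(3) by auto
  \<comment> \<open>The partial layer \<open>L\<close> counts as one more layer and a bad term costs
    another factor \<open>k\<close>, hence the exponent \<open>length Ls + 2\<close>.\<close>
  have good': "\<not> bad y" if "y \<in> ?S" for y
  proof
    assume "bad y"
    have "(x, y) \<in> moves (concat (Ls @ [L]))"
      using that by (auto simp: S(1) moves_append)
    moreover have "\<And>L'. L' \<in> set (Ls @ [L]) \<Longrightarrow> layer L'" using Ls L(1) by auto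
    ultimately obtain y' c where "bad y'" "(x, y') \<in> E ^^ c" "c \<le> k ^ Suc (length (Ls @ [L]))"
      using \<open>bad y\<close> by (metis bad_within_light_cone)
    then show False using good[of y' c] by simp
  qed
  have "card ?V \<le> (\<Sum>i\<in>set L. card (supp i))"
    by (rule card_UN_le) simp
  also have "\<dots> \<le> card (set L) * k"
    using L(1) card_supp sum_bounded_above[of "set L" "\<lambda>i. card (supp i)" k]
    by (auto simp: layer_def)
  also have "\<dots> \<le> s * k" using card_length[of L] L(2) by simp
  finally have V: "card ?V \<le> s * k" .
  have "B \<subseteq> (\<Union>q\<in>?V. {i. i < m \<and> q \<in> supp i})" by (auto simp: B_def)
  then have "card B \<le> card (\<Union>q\<in>?V. {i. i < m \<and> q \<in> supp i})"
    by (intro card_mono) auto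
  also have "\<dots> \<le> (\<Sum>q\<in>?V. card {i. i < m \<and> q \<in> supp i})"
    by (rule card_UN_le) simp
  also have "\<dots> \<le> card ?V * d"
    using degree sum_bounded_above[of ?V "\<lambda>q. card {i. i < m \<and> q \<in> supp i}" d] by simp
  also have "\<dots> \<le> s * k * d" using V by simp
  finally have "real (card B) \<le> real (s * k * d)" by (simp only: of_nat_le_iff)
  then have "real (card B) < \<epsilon> * real m / 2"
    using Suc.prems by (simp add: mult.assoc)
  moreover have "B \<subseteq> {..<m}" by (auto simp: B_def)
  ultimately obtain i where i: "i < m" "i \<notin> B"
    "(1 + \<epsilon> / 2) * real (card ?S) \<le> real (card (R i `` ?S))"
    using exists_expanding_term[OF ne good'] by metis
  have "layer (L @ [i])"
    using L(1) i(1,2) by (auto simp: layer_def sorted_wrt_append B_def)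
  moreover have "(1 + \<epsilon> / 2) ^ Suc s * real (card S) \<le> real (card (moves (L @ [i]) `` S))"
  proof -
    have "(1 + \<epsilon> / 2) * ((1 + \<epsilon> / 2) ^ s * real (card S)) \<le> (1 + \<epsilon> / 2) * real (card ?S)"
      using L(3) \<epsilon>_pos by (intro mult_left_mono) auto
    also note i(3)
    finally show ?thesis by (simp add: relcomp_Image mult.assoc)
  qed
  ultimately show ?case using L(2) by (intro exI[of _ "L @ [i]"]) simp
qed

lemma layers_growth:
  assumes "0 < d"
    and good: "\<And>y c. (x, y) \<in> E ^^ c \<Longrightarrow> c \<le> k ^ (T + 1) \<Longrightarrow> \<not> bad y"
  shows "\<exists>Ls. length Ls = T \<and> (\<forall>L\<in>set Ls. layer L) \<and>
    (1 + \<epsilon> / 2) powr (real T * (\<epsilon> * real m / (2 * real k * real d)))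
      \<le> real (card (moves (concat Ls) `` {x}))"
  using good
proof (induction T)
  case 0
  then show ?case using \<epsilon>_pos by simp
next
  case (Suc T)
  define r where "r = \<epsilon> * real m / (2 * real k * real d)"
  have r: "0 < r" using \<epsilon>_pos m_pos k_ge_2 assms(1) by (simp add: r_def)
  have "k ^ (T + 1) \<le> k ^ (Suc T + 1)" using k_ge_2 by (intro power_increasing) auto
  then have good: "\<not> bad y" if "(x, y) \<in> E ^^ c" "c \<le> k ^ (T + 1)" for y c
    using Suc.prems that order_trans by blast
  have "\<exists>Ls. length Ls = T \<and> (\<forall>L\<in>set Ls. layer L) \<and>
    (1 + \<epsilon> / 2) powr (real T * r) \<le> real (card (moves (concat Ls) `` {x}))"
    unfolding r_def by (rule Suc.IH) (erule good)
  then obtain Ls where Ls: "length Ls = T" "\<forall>L\<in>set Ls. layer L"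
    "(1 + \<epsilon> / 2) powr (real T * r) \<le> real (card (moves (concat Ls) `` {x}))"
    by blast
  define S where "S = moves (concat Ls) `` {x}"
  \<comment> \<open>Rounding up keeps the factor of a layer at least
    \<open>(1 + \<epsilon> / 2) powr r\<close>, while \<open>s - 1 < r\<close> still meets the
    condition of \<open>layer_growth\<close>, which concerns the layer before its last term is
    added.\<close>
  define s where "s = nat \<lceil>r\<rceil>"
  have s: "r \<le> real s" "real (s - 1) < r"
    using r by (simp_all add: s_def of_nat_ceiling) linarith
  have "0 < (1 + \<epsilon> / 2) powr (real T * r)" using \<epsilon>_pos by simp
  then have ne: "S \<noteq> {}" using Ls(3) by (auto simp: S_def)
  have kd: "0 < real k * real d" using k_ge_2 assms(1) by simp
  have "real (s - 1) * (real k * real d) < r * (real k * real d)"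
    using s(2) kd by (rule mult_strict_right_mono)
  also have "\<dots> = \<epsilon> * real m / 2" using k_ge_2 assms(1) by (simp add: r_def)
  finally have "real (s - 1) * (real k * real d) < \<epsilon> * real m / 2" .
  then have "\<exists>L. layer L \<and> length L = s \<and> (1 + \<epsilon> / 2) ^ s * real (card S) \<le> real (card (moves L `` S))"
    using Ls(1,2) Suc.prems by (intro layer_growth[OF _ _ S_def ne]) simp_all
  then obtain L where L: "layer L" "length L = s"
    "(1 + \<epsilon> / 2) ^ s * real (card S) \<le> real (card (moves L `` S))"
    by blast
  have "(1 + \<epsilon> / 2) powr (real (Suc T) * r) = (1 + \<epsilon> / 2) powr r * (1 + \<epsilon> / 2) powr (real T * r)"
    by (simp add: algebra_simps flip: powr_add)
  also have "\<dots> \<le> (1 + \<epsilon> / 2) powr real s * real (card S)"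
    using \<epsilon>_pos s(1) Ls(3) by (intro mult_mono powr_mono) (auto simp: S_def)
  also have "\<dots> \<le> real (card (moves L `` S))"
    using L(3) \<epsilon>_pos by (simp add: powr_realpow)
  finally show ?case
    using Ls L(1) by (intro exI[of _ "Ls @ [L]"]) (auto simp: r_def S_def moves_append relcomp_Image)
qed

section \<open>The distance bound\<close>

text \<open>Some term expands the singleton of a good string, hence links it to a string that
  differs at a qudit of its support. That qudit shows \<open>0 < d\<close>, and its two letters
  bound the alphabet.\<close>

lemma nontrivial:
  assumes "\<not> bad x"
  shows "0 < d" "2 \<le> CARD('a)"
proof -
  have "0 < \<epsilon> * real m / 2" using \<epsilon>_pos m_pos by simp
  then obtain i where i: "i < m" "(1 + \<epsilon> / 2) * real (card {x}) \<le> real (card (R i `` {x}))"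
    using exists_expanding_term[of "{x}" "{}"] assms by auto
  then have "\<not> R i `` {x} \<subseteq> {x}"
    using card_mono[of "{x}" "R i `` {x}"] \<epsilon>_pos by force
  then obtain y where y: "0 < p i x y" "y \<noteq> x" by (auto simp: R_def)
  then obtain q where q: "x q \<noteq> y q" by (metis ext)
  then have "q \<in> supp i" using p_off[OF i(1) y(1)] by auto
  then have "{i. i < m \<and> q \<in> supp i} \<noteq> {}" using i(1) by auto
  then have "0 < card {i. i < m \<and> q \<in> supp i}" by (simp add: card_gt_0_iff)
  then show "0 < d" using degree[of q] by linarith
  have "card {x q, y q} \<le> CARD('a)" by (intro card_mono) auto
  then show "2 \<le> CARD('a)" using q by simp
qed

text \<open>Growth by the factor \<open>1 + \<epsilon> / 2\<close> forces a bad string within \<open>k ^ (T + 1)\<close> steps, where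
  \<open>T \<le> T1 + 1\<close>. The weaker base \<open>1 + \<epsilon> / 4\<close> of the bound absorbs the additional summand 2,
  since \<open>T1 \<le> 2 / 3 * T0\<close> and \<open>8 \<le> T0\<close>.\<close>

lemma bad_string_nearby:
  "\<exists>y c. bad y \<and> (x, y) \<in> E ^^ c \<and>
    real c \<le> real k powr (2 * real k * real d / \<epsilon> * log (1 + \<epsilon> / 4) (real CARD('a)))"
proof (cases "bad x")
  case True
  then show ?thesis by (intro exI[of _ x] exI[of _ 0]) auto
next
  case False
  note d = nontrivial(1)[OF False] and A = nontrivial(2)[OF False]
  define C where "C = 2 * real k * real d / \<epsilon>"
  define T0 where "T0 = C * log (1 + \<epsilon> / 4) (real CARD('a))"
  define T1 where "T1 = C * log (1 + \<epsilon> / 2) (real CARD('a))"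
  \<comment> \<open>The first integer above \<open>T1\<close>: growth over that many layers would
    exceed the number of strings.\<close>
  define T where "T = nat \<lfloor>T1\<rfloor> + 1"
  have "2 \<le> k * d"
    using mult_le_mono[OF k_ge_2, of 1 d] d by simp
  then have "2 \<le> real (k * d)" by linarith
  then have "4 \<le> 2 * real k * real d" unfolding of_nat_mult by linarith
  also have "\<dots> \<le> C"
    using \<epsilon>_pos \<epsilon>_le_1 mult_left_mono[of \<epsilon> 1 "2 * real k * real d"]
    unfolding C_def by (simp add: pos_le_divide_eq)
  finally have C: "4 \<le> C" .
  have lnA: "0 < ln (real CARD('a))" using A by simp
  have l: "0 < ln (1 + \<epsilon> / 4)" "0 < ln (1 + \<epsilon> / 2)" using \<epsilon>_pos by auto
  \<comment> \<open>As \<epsilon> is at most 1, the square of the base stays below 2, so the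
    logarithm in \<open>T0\<close> is at least 2; with \<open>4 <= C\<close> this gives
    \<open>8 <= T0\<close>.\<close>
  have "(1 + \<epsilon> / 4)\<^sup>2 \<le> (5 / 4)\<^sup>2"
    using \<epsilon>_pos \<epsilon>_le_1 by (intro power_mono) auto
  also have "\<dots> \<le> (2 :: real)" by (simp add: power2_eq_square)
  also have "\<dots> \<le> real CARD('a)" using A by simp
  finally have "ln ((1 + \<epsilon> / 4)\<^sup>2) \<le> ln (real CARD('a))"
    using \<epsilon>_pos by (subst ln_le_cancel_iff) auto
  moreover have "ln ((1 + \<epsilon> / 4)\<^sup>2) = 2 * ln (1 + \<epsilon> / 4)"
    using \<epsilon>_pos by (subst ln_realpow) auto
  ultimately have "2 \<le> log (1 + \<epsilon> / 4) (real CARD('a))"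
    using l by (simp add: log_def pos_le_divide_eq)
  then have T0: "8 \<le> T0"
    using C mult_mono[of 4 C 2 "log (1 + \<epsilon> / 4) (real CARD('a))"] by (simp add: T0_def)
  \<comment> \<open>This comparison of the two bases yields \<open>3 * T1 <= 2 * T0\<close>.\<close>
  have "(1 + \<epsilon> / 4) ^ 3 \<le> (1 + \<epsilon> / 2)\<^sup>2"
  proof -
    have "\<epsilon> ^ 3 \<le> \<epsilon>" using \<epsilon>_pos \<epsilon>_le_1 power_decreasing[of 1 3 \<epsilon>] by simp
    moreover have "(1 + \<epsilon> / 2)\<^sup>2 - (1 + \<epsilon> / 4) ^ 3 = \<epsilon> / 4 + \<epsilon>\<^sup>2 / 16 - \<epsilon> ^ 3 / 64"
      by (simp add: power2_eq_square power3_eq_cube field_simps)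
    ultimately show ?thesis using \<epsilon>_pos zero_le_power2[of \<epsilon>] by linarith
  qed
  then have "ln ((1 + \<epsilon> / 4) ^ 3) \<le> ln ((1 + \<epsilon> / 2)\<^sup>2)"
    using \<epsilon>_pos by (subst ln_le_cancel_iff) auto
  moreover have "ln ((1 + \<epsilon> / 4) ^ 3) = 3 * ln (1 + \<epsilon> / 4)" "ln ((1 + \<epsilon> / 2)\<^sup>2) = 2 * ln (1 + \<epsilon> / 2)"
    using \<epsilon>_pos by (subst ln_realpow, auto)+
  ultimately have "3 * ln (1 + \<epsilon> / 4) \<le> 2 * ln (1 + \<epsilon> / 2)" by simp
  then have "3 * log (1 + \<epsilon> / 2) (real CARD('a)) \<le> 2 * log (1 + \<epsilon> / 4) (real CARD('a))"
    using l lnA by (simp add: log_def field_simps)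
  then have "C * (3 * log (1 + \<epsilon> / 2) (real CARD('a))) \<le> C * (2 * log (1 + \<epsilon> / 4) (real CARD('a)))"
    using C by (intro mult_left_mono) auto
  then have T10: "3 * T1 \<le> 2 * T0" by (simp add: T0_def T1_def)
  have "0 \<le> log (1 + \<epsilon> / 2) (real CARD('a))" using l lnA by (simp add: log_def)
  then have T1: "0 \<le> T1" using C by (simp add: T1_def)
  then have T: "T1 < real T" "real T \<le> T1 + 1" by (auto simp: T_def) linarith
  have "\<exists>y c. bad y \<and> (x, y) \<in> E ^^ c \<and> c \<le> k ^ (T + 1)"
  proof (rule ccontr)
    assume "\<not> ?thesis"
    then obtain Ls where "(1 + \<epsilon> / 2) powr (real T * (\<epsilon> * real m / (2 * real k * real d)))
        \<le> real (card (moves (concat Ls) `` {x}))"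
      using layers_growth[OF d, of x T] by blast
    also have "card (moves (concat Ls) `` {x}) \<le> CARD('n \<Rightarrow> 'a)"
      by (intro card_mono) auto
    finally have "(1 + \<epsilon> / 2) powr (real T * (real m / C)) \<le> real CARD('a) ^ CARD('n)"
      by (simp add: C_def card_fun mult.commute)
    then have "ln ((1 + \<epsilon> / 2) powr (real T * (real m / C))) \<le> ln (real CARD('a) ^ CARD('n))"
      using \<epsilon>_pos by (subst ln_le_cancel_iff) auto
    then have "real T * (real m / C) * ln (1 + \<epsilon> / 2) \<le> real CARD('n) * ln (real CARD('a))"
      using \<epsilon>_pos by (simp add: ln_realpow ln_powr)
    \<comment> \<open>Replacing the number of qudits by \<open>m\<close> lets \<open>m\<close>
      cancel.\<close>
    also have "\<dots> \<le> real m * ln (real CARD('a))"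
      using card_le_m lnA by (intro mult_right_mono) auto
    finally have "real T \<le> T1"
      using l m_pos C by (simp add: T1_def log_def field_simps)
    with T show False by simp
  qed
  then obtain y c where y: "bad y" "(x, y) \<in> E ^^ c" "c \<le> k ^ (T + 1)" by blast
  have "real c \<le> real (k ^ (T + 1))" using y(3) by (subst of_nat_le_iff)
  also have "\<dots> = real k powr real (T + 1)" using k_ge_2 by (subst powr_realpow) auto
  \<comment> \<open>\<open>T + 1 <= T1 + 2 <= 2 / 3 * T0 + 2 <= T0\<close>.\<close>
  also have "\<dots> \<le> real k powr T0"
    using k_ge_2 T T10 T0 by (intro powr_mono) auto
  finally show ?thesis using y by (auto simp: T0_def C_def)
qed

end

subsection \<open>Projectors and lifted operators\<close>

lemma inner_prod_diff_right: "inner_prod u (v - w) = inner_prod u v - inner_prod u w"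
  by (simp add: inner_prod_def algebra_simps sum_subtractf)

lemma inner_prod_zero_right [simp]: "inner_prod u 0 = 0"
  by (simp add: inner_prod_def)

lemma inner_prod_hermitian:
  assumes "hermitian A"
  shows "inner_prod u (A *v v) = inner_prod (A *v u) v"
proof -
  have "inner_prod u (A *v v) = (\<Sum>x\<in>UNIV. \<Sum>y\<in>UNIV. cnj (u $ x) * (A $ x $ y * v $ y))"
    by (simp add: inner_prod_def matrix_vector_mult_def sum_distrib_left)
  also have "\<dots> = (\<Sum>y\<in>UNIV. \<Sum>x\<in>UNIV. cnj (u $ x) * (A $ x $ y * v $ y))"
    by (rule sum.swap)
  also have "\<dots> = (\<Sum>y\<in>UNIV. \<Sum>x\<in>UNIV. cnj (A $ y $ x * u $ x) * v $ y)"
  proof (intro sum.cong refl)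
    fix x y
    have "A $ x $ y = cnj (A $ y $ x)" using assms unfolding hermitian_def by blast
    then show "cnj (u $ x) * (A $ x $ y * v $ y) = cnj (A $ y $ x * u $ x) * v $ y"
      by simp
  qed
  also have "\<dots> = inner_prod (A *v u) v"
    by (simp add: inner_prod_def matrix_vector_mult_def sum_distrib_right)
  finally show ?thesis .
qed

lemma hermitian_diff: "hermitian A \<Longrightarrow> hermitian B \<Longrightarrow> hermitian (A - B)"
  unfolding hermitian_def by (metis complex_cnj_diff vector_minus_component)

lemma hermitian_mat_1: "hermitian (mat 1)"
  by (auto simp: hermitian_def mat_def)

lemma groundspace_eq_kernel:
  assumes "smallest_eigenvalue A 0"
  shows "groundspace A = {v. A *v v = 0}"
proof -
  have "c = 0" if "smallest_eigenvalue A c" for c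
    using that assms by (meson smallest_eigenvalue_def order_antisym)
  then show ?thesis using assms by (auto simp: groundspace_def)
qed

text \<open>Taking adjoints reverses the product and fixes each of the Hermitian matrices
  involved.\<close>

lemma hermitian_product_commute:
  fixes A B :: "complex ^ 'i::finite ^ 'i"
  assumes "hermitian A" "hermitian B" "hermitian (A ** B)"
  shows "A ** B = B ** A"
proof -
  have "(A ** B) $ x $ y = (B ** A) $ x $ y" for x y
  proof -
    have "(A ** B) $ x $ y = cnj ((A ** B) $ y $ x)" using assms(3) unfolding hermitian_def by blast
    also have "\<dots> = (\<Sum>z\<in>UNIV. cnj (A $ y $ z) * cnj (B $ z $ x))"
      by (simp add: matrix_matrix_mult_def)
    also have "\<dots> = (\<Sum>z\<in>UNIV. B $ x $ z * A $ z $ y)"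
    proof (intro sum.cong refl)
      fix z
      have "A $ z $ y = cnj (A $ y $ z)" "B $ x $ z = cnj (B $ z $ x)"
        using assms(1,2) unfolding hermitian_def by blast+
      then show "cnj (A $ y $ z) * cnj (B $ z $ x) = B $ x $ z * A $ z $ y" by simp
    qed
    finally show ?thesis by (simp add: matrix_matrix_mult_def)
  qed
  then show ?thesis by (simp add: vec_eq_iff)
qed

lemma hermitian_sandwich:
  assumes "hermitian P" "hermitian U"
  shows "hermitian (P ** U ** P)"
proof -
  \<comment> \<open>Entries become inner products with basis vectors, so that
    \<open>inner_prod_hermitian\<close> can move the factors across.\<close>
  have *: "inner_prod (axis x 1) (A *v axis y 1) = A $ x $ y" for A :: "complex ^ 'a ^ 'a" and x y
    unfolding inner_prod_def
    by (subst sum.mono_neutral_right[of _ "{x}"])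
      (auto simp: axis_def matrix_vector_mult_def if_distrib[of "\<lambda>x. _ * x"] cong: if_cong)
  have cnj: "inner_prod u v = cnj (inner_prod v u)" for u v :: "complex ^ 'a"
    by (simp add: inner_prod_def mult.commute)
  show ?thesis
    unfolding hermitian_def
  proof (intro allI)
    fix x y
    have "(P ** U ** P) $ x $ y = inner_prod (axis x 1) (P *v (U *v (P *v axis y 1)))"
      by (simp only: * matrix_vector_mul_assoc matrix_mul_assoc)
    also have "\<dots> = inner_prod (P *v (U *v (P *v axis x 1))) (axis y 1)"
      by (simp add: inner_prod_hermitian assms)
    also have "\<dots> = cnj ((P ** U ** P) $ y $ x)"
      by (subst cnj) (simp only: * matrix_vector_mul_assoc matrix_mul_assoc)
    finally show "(P ** U ** P) $ x $ y = cnj ((P ** U ** P) $ y $ x)" .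
  qed
qed

text \<open>As \<open>U\<close> preserves the range of \<open>P\<close>, we have \<open>U P = P U P\<close>, which is Hermitian.\<close>

lemma projector_commute:
  fixes P U A :: "complex ^ 'i::finite ^ 'i"
  assumes P: "orthogonal_projector_onto P {v. A *v v = 0}"
    and U: "hermitian U" "U ** A = A ** U"
  shows "U ** P = P ** U"
proof -
  have hP: "hermitian P" and PP: "P ** P = P" and range: "range (\<lambda>v. P *v v) = {v. A *v v = 0}"
    using P by (auto simp: orthogonal_projector_onto_def)
  have fixed: "P *v w = w" if "A *v w = 0" for w
  proof -
    from that range obtain v where "w = P *v v" by blast
    then show ?thesis by (simp add: matrix_vector_mul_assoc PP)
  qed
  have "P ** U ** P = U ** P"
  proof -
    have "(P ** U ** P) *v v = (U ** P) *v v" for v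
    proof -
      have "A *v (P *v v) = 0" using range by blast
      then have "A *v (U *v (P *v v)) = 0"
        using U(2) by (metis matrix_vector_mul_assoc matrix_vector_mult_0_right)
      then show ?thesis using fixed by (simp flip: matrix_vector_mul_assoc)
    qed
    then show ?thesis by (simp add: matrix_eq)
  qed
  then show ?thesis
    using hermitian_product_commute[OF U(1) hP] hermitian_sandwich[OF hP U(1)] by simp
qed

text \<open>Split \<open>v = a + b\<close> with \<open>a = P v\<close> in the kernel and
  \<open>b\<close> orthogonal to it. The cross terms vanish and the form reduces to that of
  \<open>mat 1 - A\<close> at \<open>b\<close>.\<close>

lemma psd_complement_minus:
  fixes A P :: "complex ^ 'i::finite ^ 'i"
  assumes A: "psd A" "psd (mat 1 - A)" and P: "orthogonal_projector_onto P {v. A *v v = 0}"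
  shows "psd (mat 1 - P - A)"
  unfolding psd_def
proof
  have hA: "hermitian A" using A(1) by (simp add: psd_def)
  have hP: "hermitian P" and PP: "P ** P = P" and range: "range (\<lambda>v. P *v v) = {v. A *v v = 0}"
    using P by (auto simp: orthogonal_projector_onto_def)
  show "hermitian (mat 1 - P - A)"
    by (intro hermitian_diff hermitian_mat_1 hA hP)
  show "\<forall>v. 0 \<le> inner_prod v ((mat 1 - P - A) *v v)"
  proof
    fix v
    define a where "a = P *v v"
    define b where "b = v - a"
    have Aa: "A *v a = 0" unfolding a_def using range by blast
    have Pa: "P *v a = a" by (simp add: a_def matrix_vector_mul_assoc PP)
    have Pb: "P *v b = 0" by (simp add: b_def matrix_vector_mult_diff_distrib Pa) (simp add: a_def)
    have v: "v = a + b" by (simp add: b_def)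
    have "(mat 1 - P - A) *v v = b - A *v b"
      by (simp add: matrix_vector_mult_diff_rdistrib a_def[symmetric])
        (simp add: v matrix_vector_right_distrib Aa)
    moreover have "inner_prod a (A *v b) = 0"
      by (simp add: inner_prod_hermitian hA Aa) (simp add: inner_prod_def)
    moreover have "inner_prod a b = 0"
    proof -
      have "inner_prod a b = inner_prod (P *v a) b" by (simp add: Pa)
      also have "\<dots> = 0" by (simp add: Pb flip: inner_prod_hermitian[OF hP])
      finally show ?thesis .
    qed
    ultimately have "inner_prod v ((mat 1 - P - A) *v v) = inner_prod b ((mat 1 - A) *v b)"
      by (simp add: v inner_prod_diff_right matrix_vector_mult_diff_rdistrib inner_prod_def
          algebra_simps sum.distrib sum_subtractf)
    then show "0 \<le> inner_prod v ((mat 1 - P - A) *v v)"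
      using A(2) by (simp add: psd_def)
  qed
qed

section \<open>Coordinates for lifted operators\<close>

text \<open>For injective \<open>l\<close>, this inverts the restriction to \<open>l\<close> on the
  strings that agree with \<open>z\<close> outside \<open>range l\<close>; it separates local
  letters from the rest.\<close>

definition overwrite :: "('k \<Rightarrow> 'n) \<Rightarrow> ('n \<Rightarrow> 'a) \<Rightarrow> ('k \<Rightarrow> 'a) \<Rightarrow> 'n \<Rightarrow> 'a" where
  "overwrite l z u = (\<lambda>q. if q \<in> range l then u (inv l q) else z q)"

lemma overwrite_outside [simp]: "q \<notin> range l \<Longrightarrow> overwrite l z u q = z q"
  by (simp add: overwrite_def)

lemma overwrite_comp: "inj l \<Longrightarrow> overwrite l z u \<circ> l = u"
  by (auto simp: overwrite_def)

lemma overwrite_eqI: "\<forall>q. q \<notin> range l \<longrightarrow> z q = x q \<Longrightarrow> overwrite l z (x \<circ> l) = x"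
  by (auto simp: overwrite_def f_inv_into_f)

text \<open>A row of a lifted matrix vanishes off these strings, so matrix products reduce to sums
  over local strings.\<close>

lemma sum_agreeing_outside:
  fixes l :: "'k::finite \<Rightarrow> 'n::finite" and f :: "('n \<Rightarrow> 'a::finite) \<Rightarrow> 'b::comm_monoid_add"
  assumes "inj l"
  shows "(\<Sum>y\<in>UNIV. if \<forall>q. q \<notin> range l \<longrightarrow> x q = y q then f y else 0)
    = (\<Sum>u\<in>UNIV. f (overwrite l x u))"
proof -
  let ?Y = "{y. \<forall>q. q \<notin> range l \<longrightarrow> x q = y q}"
  have "(\<Sum>y\<in>UNIV. if \<forall>q. q \<notin> range l \<longrightarrow> x q = y q then f y else 0) = (\<Sum>y\<in>?Y. f y)"
    by (rule sum.mono_neutral_cong_right) auto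
  also have "\<dots> = (\<Sum>u\<in>UNIV. f (overwrite l x u))"
    by (rule sum.reindex_bij_witness[of _ "overwrite l x" "\<lambda>y. y \<circ> l"])
      (simp_all add: overwrite_comp[OF assms] overwrite_eqI)
  finally show ?thesis .
qed

lemma lift_op_mult_vec:
  fixes A :: "complex ^ ('k::finite \<Rightarrow> 'a::finite) ^ ('k \<Rightarrow> 'a)" and l :: "'k \<Rightarrow> 'n::finite"
  assumes "inj l"
  shows "(lift_op l A *v \<psi>) $ x = (A *v (\<chi> u. \<psi> $ overwrite l x u)) $ (x \<circ> l)"
proof -
  have "(lift_op l A *v \<psi>) $ x = (\<Sum>y\<in>UNIV. if \<forall>q. q \<notin> range l \<longrightarrow> x q = y q
    then A $ (x \<circ> l) $ (y \<circ> l) * \<psi> $ y else 0)"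
    unfolding matrix_vector_mult_def lift_op_def by (auto intro!: sum.cong)
  then show ?thesis
    by (simp add: sum_agreeing_outside[OF assms] overwrite_comp[OF assms] matrix_vector_mult_def)
qed

text \<open>Grouping strings by their letters outside \<open>range l\<close> cuts
  \<open>\<psi>\<close> into local vectors; the lifted form is the sum of the forms of
  \<open>A\<close> at these.\<close>

lemma psd_lift_op:
  fixes A :: "complex ^ ('k::finite \<Rightarrow> 'a::finite) ^ ('k \<Rightarrow> 'a)" and l :: "'k \<Rightarrow> 'n::finite"
  assumes "inj l" "psd A"
  shows "0 \<le> inner_prod \<psi> (lift_op l A *v \<psi>)"
proof -
  \<comment> \<open>Fixing the letters on \<open>range l\<close> picks one representative for each
    assignment of the other qudits.\<close>
  let ?Z = "{z :: 'n \<Rightarrow> 'a. \<forall>q\<in>range l. z q = undefined}"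
  define \<phi> where "\<phi> z = (\<chi> u. \<psi> $ overwrite l z u)" for z
  have ow: "overwrite l (overwrite l z u) = overwrite l z" for z u
    by (auto simp: overwrite_def fun_eq_iff)
  have "inner_prod \<psi> (lift_op l A *v \<psi>) = (\<Sum>x\<in>UNIV. cnj (\<psi> $ x) * (A *v \<phi> x) $ (x \<circ> l))"
    by (simp add: inner_prod_def lift_op_mult_vec[OF assms(1)] \<phi>_def)
  also have "\<dots> = (\<Sum>(z, u)\<in>?Z \<times> UNIV. cnj (\<psi> $ overwrite l z u) * (A *v \<phi> z) $ u)"
  proof (rule sum.reindex_bij_witness[of _ "\<lambda>(z, u). overwrite l z u"
        "\<lambda>x. (overwrite l x (\<lambda>_. undefined), x \<circ> l)"])
    fix x :: "'n \<Rightarrow> 'a"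
    show "(case (overwrite l x (\<lambda>_. undefined), x \<circ> l) of (z, u) \<Rightarrow> overwrite l z u) = x"
      by (simp add: ow overwrite_eqI)
    show "(overwrite l x (\<lambda>_. undefined), x \<circ> l) \<in> ?Z \<times> UNIV"
      by (auto simp: overwrite_def)
    show "(case (overwrite l x (\<lambda>_. undefined), x \<circ> l) of
        (z, u) \<Rightarrow> cnj (\<psi> $ overwrite l z u) * (A *v \<phi> z) $ u) =
      cnj (\<psi> $ x) * (A *v \<phi> x) $ (x \<circ> l)"
      by (simp add: \<phi>_def ow overwrite_eqI)
  next
    fix zu assume zu: "zu \<in> ?Z \<times> (UNIV :: ('k \<Rightarrow> 'a) set)"
    obtain z u where [simp]: "zu = (z, u)" by force
    have "overwrite l z (\<lambda>_. undefined) = z"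
      using zu by (auto simp: overwrite_def fun_eq_iff)
    then show "(overwrite l (case zu of (z, u) \<Rightarrow> overwrite l z u) (\<lambda>_. undefined),
        (case zu of (z, u) \<Rightarrow> overwrite l z u) \<circ> l) = zu"
      by (simp add: ow overwrite_comp[OF assms(1)])
  qed auto
  also have "\<dots> = (\<Sum>z\<in>?Z. inner_prod (\<phi> z) (A *v \<phi> z))"
    by (simp add: sum.cartesian_product[symmetric] inner_prod_def) (simp add: \<phi>_def)
  also have "0 \<le> \<dots>"
    using assms(2) by (intro sum_nonneg) (auto simp: psd_def)
  finally show ?thesis by simp
qed

lemma lift_op_diff: "lift_op l (A - B) = lift_op l A - lift_op l B"
  by (auto simp: lift_op_def vec_eq_iff)

lemma lift_op_mat_1:
  fixes l :: "'k::finite \<Rightarrow> 'n::finite"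
  shows "lift_op l (mat 1 :: complex ^ ('k \<Rightarrow> 'a::finite) ^ ('k \<Rightarrow> 'a)) = mat 1"
proof -
  have "x = y" if "\<forall>q. q \<notin> range l \<longrightarrow> x q = y q" "x \<circ> l = y \<circ> l" for x y :: "'n \<Rightarrow> 'a"
  proof
    fix q
    show "x q = y q" using that by (cases "q \<in> range l") (auto dest: fun_cong)
  qed
  then show ?thesis by (auto simp: lift_op_def mat_def vec_eq_iff)
qed

section \<open>Qudits with trivial action\<close>

lemma acts_trivially_on_outside:
  fixes A :: "complex ^ ('k::finite \<Rightarrow> 'a::finite) ^ ('k \<Rightarrow> 'a)" and l :: "'k \<Rightarrow> 'n::finite"
  assumes "q \<notin> range l"
  shows "acts_trivially_on q (lift_op l A)"
proof -
  \<comment> \<open>The lift without its equality constraint at \<open>q\<close>, which the case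
    distinction on \<open>x q = y q\<close> restores.\<close>
  define B where "B x y = (if \<forall>q'. q' \<notin> range l \<and> q' \<noteq> q \<longrightarrow> x q' = y q'
    then A $ (x \<circ> l) $ (y \<circ> l) else 0)" for x y
  have "x(q := undefined) \<circ> l = x \<circ> l" for x :: "'n \<Rightarrow> 'a"
    using assms by (auto simp: fun_eq_iff)
  then have "lift_op l A $ x $ y
    = (if x q = y q then B (x(q := undefined)) (y(q := undefined)) else 0)" for x y
    using assms by (auto simp: lift_op_def B_def)
  then show ?thesis unfolding acts_trivially_on_def by blast
qed

text \<open>Padding local strings by \<open>undefined\<close> makes each entry of \<open>A\<close>
  an entry of its lift, so triviality passes from the lift to \<open>A\<close>.\<close>

lemma acts_trivially_on_local:
  fixes A :: "complex ^ ('k::finite \<Rightarrow> 'a::finite) ^ ('k \<Rightarrow> 'a)" and l :: "'k \<Rightarrow> 'n::finite"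
  assumes "inj l" "acts_trivially_on (l j) (lift_op l A)"
  shows "u j \<noteq> v j \<Longrightarrow> A $ u $ v = 0"
    and "A $ (u(j := a)) $ (v(j := a)) = A $ (u(j := b)) $ (v(j := b))"
proof -
  define e :: "('k \<Rightarrow> 'a) \<Rightarrow> 'n \<Rightarrow> 'a" where "e = overwrite l (\<lambda>_. undefined)"
  from assms(2) obtain B where B: "\<And>x y. lift_op l A $ x $ y
    = (if x (l j) = y (l j) then B (x(l j := undefined)) (y(l j := undefined)) else 0)"
    unfolding acts_trivially_on_def by blast
  have [simp]: "e u \<circ> l = u" "e u (l j) = u j" for u
    using assms(1) by (auto simp: e_def overwrite_def)
  have "lift_op l A $ e u $ e v = A $ u $ v" for u v
    by (simp add: lift_op_def) (auto simp: e_def overwrite_def)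
  then have A: "A $ u $ v
    = (if u j = v j then B ((e u)(l j := undefined)) ((e v)(l j := undefined)) else 0)" for u v
    using B[of "e u" "e v"] by simp
  have "(e (u(j := c)))(l j := undefined) = (e u)(l j := undefined)" for u c
    using assms(1) by (auto simp: e_def overwrite_def fun_eq_iff)
  then show "A $ (u(j := a)) $ (v(j := a)) = A $ (u(j := b)) $ (v(j := b))"
    by (simp add: A)
  show "u j \<noteq> v j \<Longrightarrow> A $ u $ v = 0" by (simp add: A)
qed

text \<open>By \<open>projector_commute\<close>, \<open>P\<close> commutes with Hermitian matrices
  that commute with \<open>A\<close>: here the diagonal projector \<open>D\<close> onto one letter
  at \<open>j\<close>, and the swap \<open>U\<close> of two letters at \<open>j\<close>.\<close>

lemma projector_local_trivial:
  fixes A P :: "complex ^ ('k::finite \<Rightarrow> 'a::finite) ^ ('k \<Rightarrow> 'a)"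
  assumes P: "orthogonal_projector_onto P {v. A *v v = 0}"
    and diag: "\<And>u v. u j \<noteq> v j \<Longrightarrow> A $ u $ v = 0"
    and shift: "\<And>u v a b. A $ (u(j := a)) $ (v(j := a)) = A $ (u(j := b)) $ (v(j := b))"
  shows "u j \<noteq> v j \<Longrightarrow> P $ u $ v = 0"
    and "P $ (u(j := a)) $ (v(j := a)) = P $ (u(j := b)) $ (v(j := b))"
proof -
  define D :: "complex ^ ('k \<Rightarrow> 'a) ^ ('k \<Rightarrow> 'a)" where
    "D = (\<chi> w z. if w = z then if w j = u j then 1 else 0 else 0)"
  have DM: "(D ** M) $ w $ z = (if w j = u j then M $ w $ z else 0)"
    and MD: "(M ** D) $ w $ z = (if z j = u j then M $ w $ z else 0)" for M w z
    by (simp_all add: D_def matrix_matrix_mult_def if_distrib[of "\<lambda>x. x * _"]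
        if_distrib[of "\<lambda>x. _ * x"] cong: if_cong)
  have "D ** A = A ** D"
    by (simp add: vec_eq_iff DM MD) (metis diag)
  moreover have "hermitian D" by (auto simp: hermitian_def D_def)
  ultimately have "D ** P = P ** D" using projector_commute[OF P] by blast
  then have "(D ** P) $ u $ v = (P ** D) $ u $ v" by simp
  then show "u j \<noteq> v j \<Longrightarrow> P $ u $ v = 0" by (simp add: DM MD split: if_splits)
next
  define \<sigma> where "\<sigma> w = w(j := Transposition.transpose a b (w j))" for w :: "'k \<Rightarrow> 'a"
  have \<sigma>: "\<sigma> (\<sigma> w) = w" for w by (simp add: \<sigma>_def)
  have \<sigma>_eq: "w = \<sigma> z \<longleftrightarrow> \<sigma> w = z" for w z using \<sigma> by metis
  define U :: "complex ^ ('k \<Rightarrow> 'a) ^ ('k \<Rightarrow> 'a)" where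
    "U = (\<chi> w z. if z = \<sigma> w then 1 else 0)"
  have UM: "(U ** M) $ w $ z = M $ \<sigma> w $ z"
    and MU: "(M ** U) $ w $ z = M $ w $ \<sigma> z" for M w z
    by (simp_all add: U_def matrix_matrix_mult_def if_distrib[of "\<lambda>x. x * _"]
        if_distrib[of "\<lambda>x. _ * x"] cong: if_cong) (simp add: \<sigma>_eq)
  have "A $ \<sigma> w $ z = A $ w $ \<sigma> z" for w z
  proof (cases "\<sigma> w j = z j")
    case True
    have "\<sigma> z j = Transposition.transpose a b (\<sigma> w j)" using True by (simp add: \<sigma>_def[of z])
    then have j: "w j = \<sigma> z j" by (simp add: \<sigma>_def)
    have "A $ \<sigma> w $ z = A $ ((\<sigma> w)(j := z j)) $ (z(j := z j))" using True by (simp add: fun_upd_idem)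
    also have "\<dots> = A $ ((\<sigma> w)(j := w j)) $ (z(j := w j))" by (rule shift)
    also have "(\<sigma> w)(j := w j) = w" by (simp add: \<sigma>_def)
    also have "z(j := w j) = \<sigma> z" using j by (simp add: \<sigma>_def)
    finally show ?thesis .
  next
    case False
    then have "w j \<noteq> \<sigma> z j" by (auto simp: \<sigma>_def)
    with False show ?thesis by (simp add: diag)
  qed
  then have "U ** A = A ** U" by (simp add: vec_eq_iff UM MU)
  moreover have "hermitian U" using \<sigma> by (auto simp: hermitian_def U_def)
  ultimately have "U ** P = P ** U" using projector_commute[OF P] by blast
  \<comment> \<open>The mixed letters \<open>b\<close> and \<open>a\<close> are chosen so that the
    swap turns one side into the entry at \<open>a\<close> and the other into the entry at
    \<open>b\<close>.\<close>
  then have "(U ** P) $ (u(j := b)) $ (v(j := a)) = (P ** U) $ (u(j := b)) $ (v(j := a))" by simp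
  then show "P $ (u(j := a)) $ (v(j := a)) = P $ (u(j := b)) $ (v(j := b))"
    by (simp add: UM MU \<sigma>_def)
qed

text \<open>The positions of \<open>J\<close> are changed one at a time, in both arguments at
  once.\<close>

lemma trivial_positions_eq:
  fixes Q :: "('k \<Rightarrow> 'a) \<Rightarrow> ('k \<Rightarrow> 'a) \<Rightarrow> 'c"
  assumes "finite J"
    and shift: "\<And>j u v a b. j \<in> J \<Longrightarrow> Q (u(j := a)) (v(j := a)) = Q (u(j := b)) (v(j := b))"
    and "\<And>j. j \<in> J \<Longrightarrow> u j = v j" "\<And>j. j \<in> J \<Longrightarrow> u' j = v' j"
    and "\<And>j. j \<notin> J \<Longrightarrow> u' j = u j" "\<And>j. j \<notin> J \<Longrightarrow> v' j = v j"
  shows "Q u' v' = Q u v"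
  using assms
proof (induction J arbitrary: u v rule: finite_induct)
  case empty
  then have "u' = u" "v' = v" by auto
  then show ?case by simp
next
  case (insert j J)
  have "Q u' v' = Q (u(j := u' j)) (v(j := u' j))"
    by (rule insert.IH) (use insert in auto)
  also have "\<dots> = Q (u(j := u j)) (v(j := u j))" using insert.prems(1) by blast
  also have "v(j := u j) = v" using insert.prems(2) by (simp add: fun_upd_idem)
  finally show ?case by simp
qed

section \<open>Uniform projectors and subset states\<close>

text \<open>\<open>\<pi>\<close> is \<open>1 / card T\<close> on each block \<open>T\<close>.
  Idempotence comes from the projector; a row with nonzero diagonal entry lies in exactly one block
  by disjointness, so it sums to 1.\<close>

lemma uniform_ground_projector:
  fixes A :: "complex ^ 'i::finite ^ 'i"
  assumes "uniform_groundspace A"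
  obtains \<pi> where
    "orthogonal_projector_onto (ground_projector A) (groundspace A)"
    "\<And>u v. ground_projector A $ u $ v = complex_of_real (\<pi> u v)"
    "\<And>u v. 0 \<le> \<pi> u v"
    "\<And>u v. \<pi> u v = \<pi> v u"
    "\<And>u v. (\<Sum>w\<in>UNIV. \<pi> u w * \<pi> w v) = \<pi> u v"
    "\<And>u. \<pi> u u \<noteq> 0 \<longrightarrow> (\<Sum>v\<in>UNIV. \<pi> u v) = 1"
proof -
  from assms obtain \<T> where \<T>: "disjoint \<T>" "{} \<notin> \<T>"
    and P: "orthogonal_projector_onto
      (\<Sum>T\<in>\<T>. outer_prod (subset_state T) (subset_state T)) (groundspace A)"
    unfolding uniform_groundspace_def by blast
  define \<pi> :: "'i \<Rightarrow> 'i \<Rightarrow> real" where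
    "\<pi> u v = (\<Sum>T\<in>\<T>. if u \<in> T \<and> v \<in> T then 1 / real (card T) else 0)" for u v
  have gp: "ground_projector A = (\<Sum>T\<in>\<T>. outer_prod (subset_state T) (subset_state T))"
    using P by (rule ground_projector_eqI)
  have entry: "ground_projector A $ u $ v = complex_of_real (\<pi> u v)" for u v
  proof -
    have "outer_prod (subset_state T) (subset_state T) $ u $ v
      = complex_of_real (if u \<in> T \<and> v \<in> T then 1 / real (card T) else 0)" for T
      by (simp add: outer_prod_def subset_state_def flip: of_real_mult)
    then show ?thesis by (simp add: gp \<pi>_def)
  qed
  have "(\<Sum>w\<in>UNIV. \<pi> u w * \<pi> w v) = \<pi> u v" for u v
  proof -
    have "ground_projector A ** ground_projector A = ground_projector A"
      using P by (simp add: gp orthogonal_projector_onto_def)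
    then have "(ground_projector A ** ground_projector A) $ u $ v = ground_projector A $ u $ v"
      by simp
    then have "complex_of_real (\<Sum>w\<in>UNIV. \<pi> u w * \<pi> w v) = complex_of_real (\<pi> u v)"
      by (simp add: matrix_matrix_mult_def entry)
    then show ?thesis by (simp only: of_real_eq_iff)
  qed
  moreover have "(\<Sum>v\<in>UNIV. \<pi> u v) = 1" if u: "\<pi> u u \<noteq> 0" for u
  proof -
    from u obtain T where T: "T \<in> \<T>" "u \<in> T"
      unfolding \<pi>_def by (metis (mono_tags, lifting) sum.neutral)
    have "(\<Sum>v\<in>UNIV. \<pi> u v) = (\<Sum>T'\<in>\<T>. \<Sum>v\<in>UNIV. if u \<in> T' \<and> v \<in> T' then 1 / real (card T') else 0)"
      unfolding \<pi>_def by (rule sum.swap)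
    also have "\<dots> = (\<Sum>T'\<in>{T}. \<Sum>v\<in>UNIV. if u \<in> T' \<and> v \<in> T' then 1 / real (card T') else 0)"
    proof (rule sum.mono_neutral_right)
      have "u \<notin> T'" if "T' \<in> \<T>" "T' \<noteq> T" for T'
        using that T \<T>(1) by (auto simp: disjoint_def)
      then show "\<forall>T'\<in>\<T> - {T}. (\<Sum>v\<in>UNIV. if u \<in> T' \<and> v \<in> T' then 1 / real (card T') else 0) = 0"
        by simp
    qed (use T in auto)
    also have "\<dots> = (\<Sum>v\<in>T. 1 / real (card T))"
      using T(2) by (simp add: sum.If_cases)
    also have "\<dots> = 1" using T(2) by auto
    finally show ?thesis .
  qed
  moreover have "0 \<le> \<pi> u v" "\<pi> u v = \<pi> v u" for u v
    unfolding \<pi>_def by (auto intro!: sum_nonneg sum.cong)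
  ultimately show ?thesis using that[of \<pi>] P entry by (simp add: gp)
qed

lemma inner_prod_subset_state:
  "inner_prod (subset_state S) (M *v subset_state S)
    = (\<Sum>x\<in>S. \<Sum>y\<in>S. M $ x $ y) / complex_of_real (real (card S))"
proof -
  define c where "c = 1 / complex_of_real (sqrt (real (card S)))"
  have c: "cnj c * c = 1 / complex_of_real (real (card S))"
    by (simp add: c_def flip: of_real_mult)
  have ss: "subset_state S $ x = (if x \<in> S then c else 0)" for x
    by (simp add: subset_state_def c_def)
  have "(\<Sum>y\<in>UNIV. M $ x $ y * (if y \<in> S then c else 0)) = (\<Sum>y\<in>S. M $ x $ y * c)" for x
    by (rule sum.mono_neutral_cong_right) auto
  then have "inner_prod (subset_state S) (M *v subset_state S)
      = (\<Sum>x\<in>UNIV. cnj (if x \<in> S then c else 0) * (\<Sum>y\<in>S. M $ x $ y * c))"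
    by (simp add: inner_prod_def matrix_vector_mult_def ss)
  also have "\<dots> = (\<Sum>x\<in>S. cnj c * (\<Sum>y\<in>S. M $ x $ y * c))"
    by (rule sum.mono_neutral_cong_right) auto
  also have "\<dots> = (cnj c * c) * (\<Sum>x\<in>S. \<Sum>y\<in>S. M $ x $ y)"
    by (simp add: sum_distrib_left mult_ac)
  finally show ?thesis by (simp add: c)
qed

lemma norm_subset_state:
  assumes "S \<noteq> {}"
  shows "norm (subset_state S :: complex ^ 'i::finite) = 1"
proof -
  have "(\<Sum>x\<in>UNIV. (cmod (subset_state S $ x))\<^sup>2) = (\<Sum>x\<in>S. 1 / real (card S))"
    by (rule sum.mono_neutral_cong_right) (auto simp: subset_state_def norm_divide power_divide)
  also have "\<dots> = 1" using assms by auto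
  finally show ?thesis by (simp add: norm_vec_def L2_set_def)
qed

section \<open>Application to the Hamiltonian\<close>

theorem lemma4p1:
  fixes m d :: nat
    and loc :: "nat \<Rightarrow> 'k::finite \<Rightarrow> 'n::finite"
    and h :: "nat \<Rightarrow> complex ^ ('k \<Rightarrow> 'a::finite) ^ ('k \<Rightarrow> 'a)"
    and \<epsilon> :: real
    and x :: "'n \<Rightarrow> 'a"
  assumes "CARD('k) \<ge> 2"
    and "uniform_stoquastic_terms m d loc h"
    and "\<epsilon> > 0"
    and "frustrated \<epsilon> (hamiltonian m loc h)"
  shows "\<exists>y. bad_string m loc h y \<and>
    ereal_of_enat (graph_dist (config_graph m loc h) x y) \<le>
      ereal (real CARD('k) powr
        (2 * real CARD('k) * real d / \<epsilon> * log (1 + \<epsilon> / 4) (real CARD('a))))"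
proof -
  define supp where "supp i = {q. \<not> acts_trivially_on q (lift_op (loc i) (h i))}" for i
  define p where "p i x y = Re (lifted_projector loc h i $ x $ y)" for i x y
  have nm: "CARD('n) \<le> m"
    and deg: "card {i. i < m \<and> \<not> acts_trivially_on q (lift_op (loc i) (h i))} \<le> d" for q
    using assms(2) unfolding uniform_stoquastic_terms_def by blast+
  have terms: "inj (loc i)" "psd (h i)" "psd (mat 1 - h i)" "smallest_eigenvalue (h i) 0"
    "uniform_groundspace (h i)" if "i < m" for i
    using assms(2) that unfolding uniform_stoquastic_terms_def loewner_le_def by auto
  have proj: "orthogonal_projector_onto (ground_projector (h i)) {v. h i *v v = 0}" if i: "i < m" for i
    by (rule uniform_ground_projector[OF terms(5)[OF i]])
      (simp add: groundspace_eq_kernel[OF terms(4)[OF i]])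
  \<comment> \<open>Trivial action passes from a term to its ground projector, so supports defined
    from \<open>h i\<close> also govern \<open>p i\<close>.\<close>
  have triv: "(u j \<noteq> v j \<longrightarrow> ground_projector (h i) $ u $ v = 0) \<and>
      ground_projector (h i) $ (u(j := a)) $ (v(j := a)) = ground_projector (h i) $ (u(j := b)) $ (v(j := b))"
    if i: "i < m" and j: "loc i j \<notin> supp i" for i j u v a b
  proof -
    have "acts_trivially_on (loc i j) (lift_op (loc i) (h i))" using j by (simp add: supp_def)
    note loc = acts_trivially_on_local[OF terms(1)[OF i] this]
    have "u j \<noteq> v j \<Longrightarrow> ground_projector (h i) $ u $ v = 0"
      by (rule projector_local_trivial(1)[OF proj[OF i], of j]) (auto intro: loc(1), rule loc(2))
    moreover have "ground_projector (h i) $ (u(j := a)) $ (v(j := a)) =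
        ground_projector (h i) $ (u(j := b)) $ (v(j := b))"
      by (rule projector_local_trivial(2)[OF proj[OF i], of j]) (auto intro: loc(1), rule loc(2))
    ultimately show ?thesis by simp
  qed
  have supp_range: "supp i \<subseteq> range (loc i)" for i
    unfolding supp_def using acts_trivially_on_outside[of _ "loc i" "h i"] by blast
  have p_eq: "p i x y = (if \<forall>q. q \<notin> range (loc i) \<longrightarrow> x q = y q
      then Re (ground_projector (h i) $ (x \<circ> loc i) $ (y \<circ> loc i)) else 0)" for i x y
    by (auto simp: p_def lifted_projector_def lift_op_def)
  have p_real: "lifted_projector loc h i $ x $ y = complex_of_real (p i x y)" if "i < m" for i x y
    by (rule uniform_ground_projector[OF terms(5)[OF that]])
      (auto simp: p_def lifted_projector_def lift_op_def)
  interpret local_relations m "CARD('k)" d \<epsilon> supp p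
  proof
    show "2 \<le> CARD('k)" "CARD('n) \<le> m" "0 < \<epsilon>" by (fact assms nm)+
    show "card {i. i < m \<and> q \<in> supp i} \<le> d" for q using deg by (simp add: supp_def)
  next
    fix i assume i: "i < m"
    let ?l = "loc i"
    obtain \<pi> where "orthogonal_projector_onto (ground_projector (h i)) (groundspace (h i))"
      and \<pi>:
      "\<And>u v. ground_projector (h i) $ u $ v = complex_of_real (\<pi> u v)"
      "\<And>u v. 0 \<le> \<pi> u v" "\<And>u v. \<pi> u v = \<pi> v u"
      "\<And>u v. (\<Sum>w\<in>UNIV. \<pi> u w * \<pi> w v) = \<pi> u v"
      "\<And>u. \<pi> u u \<noteq> 0 \<longrightarrow> (\<Sum>v\<in>UNIV. \<pi> u v) = 1"
      by (rule uniform_ground_projector[OF terms(5)[OF i]]) (rule that)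
    define agree where "agree x y \<longleftrightarrow> (\<forall>q. q \<notin> range ?l \<longrightarrow> x q = y q)" for x y :: "'n \<Rightarrow> 'a"
    have p: "p i x y = (if agree x y then \<pi> (x \<circ> ?l) (y \<circ> ?l) else 0)" for x y
      unfolding p_eq agree_def[symmetric] by (simp add: \<pi>(1))
    have agree_overwrite: "agree (overwrite ?l x u) y = agree x y" "agree x (overwrite ?l x u)" for x y u
      by (simp_all add: agree_def)
    have sum_agree: "(\<Sum>y\<in>UNIV. if agree x y then f y else 0) = (\<Sum>u\<in>UNIV. f (overwrite ?l x u))"
      for x and f :: "('n \<Rightarrow> 'a) \<Rightarrow> real"
      unfolding agree_def by (rule sum_agreeing_outside[OF terms(1)[OF i]])
    note comp = overwrite_comp[OF terms(1)[OF i]]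
    show "card (supp i) \<le> CARD('k)"
      using card_mono[OF _ supp_range[of i]] card_image_le[of UNIV ?l] by simp
    show "0 \<le> p i x y" for x y by (simp add: p \<pi>(2))
    show "p i x y = p i y x" for x y using \<pi>(3) by (auto simp: p agree_def)
    show "(\<Sum>z\<in>UNIV. p i x z * p i z y) = p i x y" for x y
    proof -
      have "(\<Sum>z\<in>UNIV. p i x z * p i z y) = (\<Sum>z\<in>UNIV. if agree x z
          then \<pi> (x \<circ> ?l) (z \<circ> ?l) * p i z y else 0)"
        by (intro sum.cong refl) (simp add: p)
      also have "\<dots> = (\<Sum>u\<in>UNIV. \<pi> (x \<circ> ?l) u * p i (overwrite ?l x u) y)"
        unfolding sum_agree comp ..
      also have "\<dots> = p i x y"
        by (simp add: p comp agree_overwrite \<pi>(4))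
      finally show ?thesis .
    qed
    show "(\<Sum>y\<in>UNIV. p i x y) = 1" if "p i x x \<noteq> 0" for x
      using that by (simp add: p sum_agree comp \<pi>(5) split: if_splits)
    show off: "x q = y q" if "0 < p i x y" "q \<notin> supp i" for x y q
    proof (cases "q \<in> range ?l")
      case True
      then obtain j where q: "q = ?l j" by blast
      show ?thesis
      proof (rule ccontr)
        assume "x q \<noteq> y q"
        then have "ground_projector (h i) $ (x \<circ> ?l) $ (y \<circ> ?l) = 0"
          using triv[OF i, of j "x \<circ> ?l" "y \<circ> ?l"] that(2) q by simp
        then show False using that(1) by (simp add: p_eq split: if_splits)
      qed
    next
      case False
      then show ?thesis using that(1) by (auto simp: p agree_def split: if_splits)
    qed
    show "p i x' y' = p i x y"
      if off: "\<And>q. q \<notin> supp i \<Longrightarrow> x q = y q" "\<And>q. q \<notin> supp i \<Longrightarrow> x' q = y' q"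
        and on: "\<And>q. q \<in> supp i \<Longrightarrow> x' q = x q" "\<And>q. q \<in> supp i \<Longrightarrow> y' q = y q"
      for x y x' y'
    proof -
      have "\<pi> (x' \<circ> ?l) (y' \<circ> ?l) = \<pi> (x \<circ> ?l) (y \<circ> ?l)"
      proof (rule trivial_positions_eq[where Q = \<pi> and J = "{j. ?l j \<notin> supp i}"])
        fix j u v a b assume "j \<in> {j. ?l j \<notin> supp i}"
        then show "\<pi> (u(j := a)) (v(j := a)) = \<pi> (u(j := b)) (v(j := b))"
          using triv[OF i, of j u v a b] by (simp add: \<pi>(1))
      qed (use off on in auto)
      moreover have "agree x y" "agree x' y'"
        using supp_range off unfolding agree_def by blast+
      ultimately show ?thesis by (simp add: p)
    qed
  next
    fix S :: "('n \<Rightarrow> 'a) set"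
    define \<psi> where "\<psi> = (subset_state S :: complex ^ ('n \<Rightarrow> 'a))"
    define s where "s = real (card S)"
    have rayleigh: "Re (inner_prod \<psi> (M *v \<psi>)) = (\<Sum>x\<in>S. \<Sum>y\<in>S. Re (M $ x $ y)) / s" for M
      by (simp add: \<psi>_def s_def inner_prod_subset_state)
    show "\<epsilon> * real m * real (card S) \<le> (\<Sum>i<m. real (card S) - (\<Sum>x\<in>S. \<Sum>y\<in>S. p i x y))"
    \<comment> \<open>Only a nonempty \<open>S\<close> gives a unit vector; for empty
      \<open>S\<close> both sides are 0.\<close>
    proof (cases "S = {}")
      case False
      then have s: "0 < s" by (simp add: s_def card_gt_0_iff)
      have m: "0 < real m" using nm by (metis of_nat_0_less_iff zero_less_card_finite less_le_trans)
      have "\<epsilon> \<le> Re (inner_prod \<psi> (hamiltonian m loc h *v \<psi>))"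
        using assms(4) norm_subset_state[OF False]
        by (auto simp: frustrated_def less_eq_complex_def \<psi>_def)
      also have "\<dots> = (\<Sum>x\<in>S. \<Sum>y\<in>S. \<Sum>i<m. Re (lift_op (loc i) (h i) $ x $ y)) / (real m * s)"
        unfolding rayleigh by (simp add: hamiltonian_def flip: sum_divide_distrib)
      also have "(\<Sum>x\<in>S. \<Sum>y\<in>S. \<Sum>i<m. Re (lift_op (loc i) (h i) $ x $ y))
        = (\<Sum>i<m. \<Sum>x\<in>S. \<Sum>y\<in>S. Re (lift_op (loc i) (h i) $ x $ y))"
        by (simp add: sum.swap[of _ "{..<m}"])
      finally have "\<epsilon> * (real m * s) \<le> (\<Sum>i<m. \<Sum>x\<in>S. \<Sum>y\<in>S. Re (lift_op (loc i) (h i) $ x $ y))"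
        using s m by (simp add: pos_le_divide_eq)
      also have "\<dots> \<le> (\<Sum>i<m. s - (\<Sum>x\<in>S. \<Sum>y\<in>S. p i x y))"
      proof (rule sum_mono)
        fix i assume "i \<in> {..<m}"
        then have i: "i < m" by simp
        \<comment> \<open>The operator inequality between \<open>H_i\<close> and
          \<open>I - P_i\<close>, lifted and evaluated at \<open>|S>\<close>.\<close>
        have "0 \<le> Re (inner_prod \<psi> (lift_op (loc i) (mat 1 - ground_projector (h i) - h i) *v \<psi>))"
          using psd_lift_op[OF terms(1)[OF i] psd_complement_minus[OF terms(2,3)[OF i] proj[OF i]], of \<psi>]
          by (simp add: less_eq_complex_def)
        then have "0 \<le> (\<Sum>x\<in>S. \<Sum>y\<in>S. Re (mat 1 $ x $ y) - p i x y - Re (lift_op (loc i) (h i) $ x $ y))"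
          using s by (simp add: rayleigh lift_op_diff lift_op_mat_1 zero_le_divide_iff p_def lifted_projector_def)
        also have "\<dots> = (\<Sum>x\<in>S. \<Sum>y\<in>S. Re (mat 1 $ x $ y)) - (\<Sum>x\<in>S. \<Sum>y\<in>S. p i x y)
            - (\<Sum>x\<in>S. \<Sum>y\<in>S. Re (lift_op (loc i) (h i) $ x $ y))"
          by (simp add: sum_subtractf)
        also have "(\<Sum>x\<in>S. \<Sum>y\<in>S. Re (mat 1 $ x $ y)) = s"
          by (simp add: mat_def s_def if_distrib[of Re] cong: if_cong)
        finally show "(\<Sum>x\<in>S. \<Sum>y\<in>S. Re (lift_op (loc i) (h i) $ x $ y)) \<le> s - (\<Sum>x\<in>S. \<Sum>y\<in>S. p i x y)"
          by simp
      qed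
      finally show ?thesis by (simp add: s_def mult.assoc)
    qed simp
  qed
  have E: "E = config_graph m loc h"
    by (auto simp: E_def R_def config_graph_def p_real less_complex_def)
  have bad: "bad y \<longleftrightarrow> bad_string m loc h y" for y
    by (auto simp: bad_def bad_string_def p_real)
  obtain y c where y: "bad y" "(x, y) \<in> E ^^ c"
    "real c \<le> real CARD('k) powr (2 * real CARD('k) * real d / \<epsilon> * log (1 + \<epsilon> / 4) (real CARD('a)))"
    using bad_string_nearby by blast
  have "graph_dist (config_graph m loc h) x y \<le> enat c"
    unfolding graph_dist_def using y(2) by (intro INF_lower) (simp add: E)
  then have "ereal_of_enat (graph_dist (config_graph m loc h) x y) \<le> ereal_of_enat (enat c)"
    by (simp only: ereal_of_enat_le_iff)
  also have "\<dots> \<le> ereal (real CARD('k) powr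
      (2 * real CARD('k) * real d / \<epsilon> * log (1 + \<epsilon> / 4) (real CARD('a))))"
    using y(3) by simp
  finally show ?thesis using y(1) bad by blast
qed

end
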